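(* Let $n>m$, let $\hat\Sigma_C$ be a real symmetric positive definite $n\times n$ matrix and $\nu\in\mathbb{N}_+=\{1,2,\dots\}$. Then the problem $$\text{minimize } \mathcal{D}_T^{(1-\nu^{-1})}(\hat\Sigma\|\hat\Sigma_C)\ \text{ over }\ \{\hat\Sigma\in\mathcal{Q}_{n,+}: V(\hat\Sigma)=0\}$$ admits a unique solution.
   Context: $\mathcal{Q}_n$ denotes the space of real symmetric $n\times n$ matrices and $\mathcal{Q}_{n,+}$ its cone of positive definite elements. $A\in\mathbb{R}^{n\times n}$ has all eigenvalues in the open unit disk, $B\in\mathbb{R}^{n\times m}$ has full column rank and $(A,B)$ is reachable. $\Pi_B^\perp:=I-B(B^TB)^{-1}B^T$ and $V:\mathcal{Q}_n\to\mathcal{Q}_n$, $V(Q)=\Pi_B^\perp(Q-AQA^T)\Pi_B^\perp$. For $P,Q\in\mathcal{Q}_{n,+}$, let $L_Q$ be the Cholesky factor of $Q$ ($Q=L_QL_Q^T$); for $\tau\in\mathbb{R}\setminus\{0,1\}$, $$\mathcal{D}_T^{(\tau)}(P\|Q):=\operatorname{tr}\Big[\tfrac{1}{\tau(\tau-1)}(L_Q^{-1}PL_Q^{-T})^{\tau}-\tfrac{1}{\tau-1}PQ^{-1}\Big]+\tfrac{n}{\tau}$$ (the additive constant does not affect minimizers), and for $\tau=0$ it is the continuous extension $\mathcal{D}_T^{(0)}(P\|Q)=\operatorname{tr}[\log Q-\log P+PQ^{-1}]-n$ (Burg matrix divergence). Matrix powers and logarithms are via spectral calculus. *)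

theory Defs
  imports "HOL-Analysis.Analysis"
begin

type_synonym 'n rmat = "((real, 'n) vec, 'n) vec"

definition sym_mat :: "real^'n^'n \<Rightarrow> bool" where
  "sym_mat Q \<longleftrightarrow> transpose Q = Q"

definition pos_def :: "real^'n^'n \<Rightarrow> bool" where
  "pos_def Q \<longleftrightarrow> sym_mat Q \<and> (\<forall>x. x \<noteq> 0 \<longrightarrow> x \<bullet> (Q *v x) > 0)"

definition diag_mat :: "('n \<Rightarrow> real) \<Rightarrow> real^'n^'n" where
  "diag_mat d = (\<chi> i j. if i = j then d i else 0)"

definition mat_fun :: "(real \<Rightarrow> real) \<Rightarrow> real^'n^'n \<Rightarrow> real^'n^'n" where
  "mat_fun f M = (THE X. \<exists>U d. orthogonal_matrix U \<and> M = U ** diag_mat d ** transpose U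
                          \<and> X = U ** diag_mat (\<lambda>i. f (d i)) ** transpose U)"

definition mat_powr :: "real^'n^'n \<Rightarrow> real \<Rightarrow> real^'n^'n" where
  "mat_powr M t = mat_fun (\<lambda>x. x powr t) M"

definition mat_log :: "real^'n^'n \<Rightarrow> real^'n^'n" where
  "mat_log M = mat_fun ln M"

definition lower_triangular :: "('n::{finite,linorder}) rmat \<Rightarrow> bool" where
  "lower_triangular L \<longleftrightarrow> (\<forall>i j. i < j \<longrightarrow> L $ i $ j = 0)"

definition chol :: "('n::{finite,linorder}) rmat \<Rightarrow> 'n rmat" where
  "chol Q = (THE L. lower_triangular L \<and> (\<forall>i. L $ i $ i > 0) \<and> Q = L ** transpose L)"

definition D_T :: "real \<Rightarrow> ('n::{finite,linorder}) rmat \<Rightarrow> 'n rmat \<Rightarrow> real" where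
  "D_T tau P Q =
     (if tau = 0 then
        trace (mat_log Q - mat_log P + P ** matrix_inv Q) - real CARD('n)
      else
        trace ((1 / (tau * (tau - 1))) *\<^sub>R
                 mat_powr (matrix_inv (chol Q) ** P ** transpose (matrix_inv (chol Q))) tau
               - (1 / (tau - 1)) *\<^sub>R (P ** matrix_inv Q))
        + real CARD('n) / tau)"

definition schur_stable :: "real^'n^'n \<Rightarrow> bool" where
  "schur_stable A \<longleftrightarrow>
     (\<forall>(lam::complex) (v::complex^'n). v \<noteq> 0 \<and>
        (\<chi> i. \<Sum>j\<in>UNIV. complex_of_real (A $ i $ j) * v $ j) = lam *s v \<longrightarrow> cmod lam < 1)"

definition reachable :: "real^'n^'n \<Rightarrow> real^'m^'n \<Rightarrow> bool" where
  "reachable A B \<longleftrightarrow>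
     span (\<Union>k\<in>{..<CARD('n)}. columns (((\<lambda>M. A ** M) ^^ k) B)) = UNIV"

definition proj_perp :: "real^'m^'n \<Rightarrow> real^'n^'n" where
  "proj_perp B = mat 1 - B ** matrix_inv (transpose B ** B) ** transpose B"

definition V_op :: "real^'n^'n \<Rightarrow> real^'m^'n \<Rightarrow> real^'n^'n \<Rightarrow> real^'n^'n" where
  "V_op A B Q = proj_perp B ** (Q - A ** Q ** transpose A) ** proj_perp B"

end

theory Submission
  imports Defs "HOL-Computational_Algebra.Fundamental_Theorem_Algebra" "HOL-Real_Asymp.Real_Asymp"
begin

text \<open>With \<open>P = L\<inverse> \<Sigma> L\<^sup>-\<^sup>T\<close> for the Cholesky factor \<open>L\<close> of the reference matrix, the divergence is, up to
  a constant, \<open>F P = tr (f P)\<close> for a scalar \<open>f\<close> with \<open>f' x = (x\<^bsup>\<tau>-1\<^esup> - 1) / (\<tau> - 1)\<close>: for \<open>\<tau> < 1\<close> this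
  derivative is strictly increasing, tends to \<open>-\<infinity>\<close> at \<open>0\<close> and is eventually positive. Klein's
  inequality \<open>F X \<ge> F Y + tr (f' Y (X - Y))\<close>, strict for \<open>X \<noteq> Y\<close>, gives uniqueness (compare with the
  midpoint) and lower semicontinuity of \<open>F\<close>. Since \<open>f'\<close> is very negative near \<open>0\<close>, a nearly singular \<open>P\<close>
  can be moved a fixed distance towards a positive definite feasible point without increasing \<open>F\<close>,
  so it suffices to minimise over a compact set. A feasible point is the reachability Gramian
  \<open>\<Sum>k. A\<^sup>k B B\<^sup>T (A\<^sup>k)\<^sup>T\<close>.\<close>

section \<open>The spectral theorem\<close>

text \<open>A first-order condition: near \<open>t = 0\<close> the linear term dominates, so a
  nonzero \<open>b\<close> would produce a negative value.\<close>

lemma quadratic_nonneg_imp_linear_zero: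
  fixes b c :: real
  assumes "\<And>t. 0 \<le> 2 * t * b + t\<^sup>2 * c"
  shows "b = 0"
proof (rule ccontr)
  assume "b \<noteq> 0"
  \<comment> \<open>\<open>k\<close> is positive with \<open>c < 2 * k\<close>, so the step
    \<open>t = - b / k\<close> is short enough for the linear term to win.\<close>
  define k where "k = \<bar>c\<bar> + 1"
  have k: "k > 0" "c < 2 * k" by (auto simp: k_def)
  have "2 * (- b / k) * b + (- b / k)\<^sup>2 * c = b\<^sup>2 / k\<^sup>2 * (c - 2 * k)"
    using k by (simp add: field_simps power2_eq_square)
  moreover have "b\<^sup>2 / k\<^sup>2 * (c - 2 * k) < 0"
    using k \<open>b \<noteq> 0\<close> by (intro mult_pos_neg) auto
  ultimately show False using assms[of "- b / k"] by linarith
qed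

text \<open>Maximise the Rayleigh quotient on the unit sphere of \<open>S\<close>. With maximum
  \<open>c\<close> attained at \<open>v\<close>, the form
  \<open>c * (x \<bullet> x) - x \<bullet> f x\<close> is nonnegative on \<open>S\<close> and
  vanishes at \<open>v\<close>. Its first variation there is zero, so \<open>c v - f v\<close> is
  orthogonal to \<open>S\<close>; as it lies in \<open>S\<close>, it vanishes.\<close>

lemma self_adjoint_eigenvector_exists:
  fixes f :: "'a::euclidean_space \<Rightarrow> 'a"
  assumes f: "linear f" and adj: "\<And>x y. x \<bullet> f y = f x \<bullet> y"
    and S: "subspace S" "f ` S \<subseteq> S" "S \<noteq> {0}"
  obtains v c where "v \<in> S" "norm v = 1" "f v = c *\<^sub>R v"
proof -
  have "compact (sphere 0 1 \<inter> S)"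
    by (intro compact_Int_closed compact_sphere closed_subspace S)
  moreover have "sphere 0 1 \<inter> S \<noteq> {}"
  proof -
    obtain x where "x \<in> S" "x \<noteq> 0" using S subspace_0 by blast
    then have "(1 / norm x) *\<^sub>R x \<in> sphere 0 1 \<inter> S"
      using S by (auto simp: subspace_scale)
    then show ?thesis by blast
  qed
  moreover have "continuous_on (sphere 0 1 \<inter> S) (\<lambda>x. x \<bullet> f x)"
    by (intro continuous_intros linear_continuous_on) (use f linear_conv_bounded_linear in blast)
  ultimately obtain v where v: "v \<in> sphere 0 1 \<inter> S"
    and max: "\<And>y. y \<in> sphere 0 1 \<inter> S \<Longrightarrow> y \<bullet> f y \<le> v \<bullet> f v"
    using continuous_attains_sup by metis
  define c where "c = v \<bullet> f v"
  have ge: "0 \<le> c * (x \<bullet> x) - x \<bullet> f x" if "x \<in> S" for x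
  proof (cases "x = 0")
    case False
    define y where "y = (1 / norm x) *\<^sub>R x"
    have "y \<in> sphere 0 1 \<inter> S"
      using S that False by (auto simp: y_def subspace_scale)
    from max[OF this] have "(x \<bullet> f x) / (norm x)\<^sup>2 \<le> c"
      by (simp add: y_def c_def linear_scale[OF f] power2_eq_square)
    then show ?thesis
      using False by (simp add: field_simps power2_norm_eq_inner)
  qed (simp add: linear_0[OF f])
  have vv: "v \<in> S" "v \<bullet> v = 1" using v by (auto simp: dot_square_norm)
  have orth: "w \<bullet> (c *\<^sub>R v - f v) = 0" if w: "w \<in> S" for w
  proof (rule quadratic_nonneg_imp_linear_zero)
    fix t
    have "v + t *\<^sub>R w \<in> S" using vv w S by (simp add: subspace_add subspace_scale)
    from ge[OF this] show "0 \<le> 2 * t * (w \<bullet> (c *\<^sub>R v - f v)) + t\<^sup>2 * (c * (w \<bullet> w) - w \<bullet> f w)"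
      using vv adj[of v w]
      by (simp add: linear_add[OF f] linear_scale[OF f] inner_simps c_def power2_eq_square
          algebra_simps inner_commute)
  qed
  have "c *\<^sub>R v - f v \<in> S" using vv S by (auto intro!: subspace_diff subspace_scale)
  from orth[OF this] have "f v = c *\<^sub>R v" by simp
  then show thesis using that vv v by auto
qed

text \<open>Induction on the dimension: split off a unit eigenvector. Its orthogonal complement
  inside \<open>S\<close> is again invariant because \<open>f\<close> is self-adjoint.\<close>

lemma self_adjoint_orthonormal_eigenbasis:
  fixes f :: "'a::euclidean_space \<Rightarrow> 'a"
  assumes f: "linear f" and adj: "\<And>x y. x \<bullet> f y = f x \<bullet> y"
    and S: "subspace S" "f ` S \<subseteq> S"
  shows "\<exists>B. B \<subseteq> S \<and> pairwise orthogonal B \<and> S \<subseteq> span B \<and>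
    (\<forall>v\<in>B. norm v = 1 \<and> (\<exists>c. f v = c *\<^sub>R v))"
  using S
proof (induction "dim S" arbitrary: S rule: less_induct)
  case less
  show ?case
  proof (cases "S = {0}")
    case True
    then show ?thesis by (intro exI[of _ "{}"]) auto
  next
    case False
    then obtain v c where v: "v \<in> S" "norm v = 1" "f v = c *\<^sub>R v"
      using self_adjoint_eigenvector_exists[OF f adj less.prems] by metis
    have vv: "v \<bullet> v = 1" using v by (simp add: dot_square_norm)
    define T where "T = {x \<in> S. v \<bullet> x = 0}"
    have "subspace T"
      using less.prems(1) by (auto simp: T_def subspace_def inner_simps)
    moreover have "f ` T \<subseteq> T"
      using less.prems(2) adj[of v] v by (auto simp: T_def)
    moreover have "dim T < dim S"
    proof (rule dim_psubset)
      have "v \<notin> T" using vv by (auto simp: T_def)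
      moreover have "T \<subseteq> S" by (auto simp: T_def)
      ultimately have "T \<subset> S" using v by blast
      then show "span T \<subset> span S"
        using \<open>subspace T\<close> less.prems(1) by (metis span_eq_iff)
    qed
    ultimately obtain B where B: "B \<subseteq> T" "pairwise orthogonal B" "T \<subseteq> span B"
        "\<And>v. v \<in> B \<Longrightarrow> norm v = 1 \<and> (\<exists>c. f v = c *\<^sub>R v)"
      using less.hyps[of T] by blast
    have "S \<subseteq> span (insert v B)"
    proof
      fix x assume x: "x \<in> S"
      have "x - (v \<bullet> x) *\<^sub>R v \<in> T"
        using x v vv less.prems(1) by (auto simp: T_def inner_simps intro!: subspace_diff subspace_scale)
      then show "x \<in> span (insert v B)"
        using B(3) span_breakdown_eq[of x v B] by blast
    qed
    moreover have "pairwise orthogonal (insert v B)"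
      using B(1,2) by (auto simp: pairwise_insert T_def orthogonal_def inner_commute)
    moreover have "insert v B \<subseteq> S" using B(1) v by (auto simp: T_def)
    ultimately show ?thesis
      using B(4) v by (intro exI[of _ "insert v B"]) auto
  qed
qed

lemma sym_mat_inner:
  assumes "sym_mat M"
  shows "x \<bullet> (M *v y) = (M *v x) \<bullet> y"
  using assms by (metis dot_lmul_matrix sym_mat_def transpose_matrix_vector)

theorem spectral_theorem:
  fixes M :: "real^'n^'n"
  assumes "sym_mat M"
  obtains U d where "orthogonal_matrix U" "M = U ** diag_mat d ** transpose U"
proof -
  obtain B where B: "pairwise orthogonal B" "UNIV \<subseteq> span B"
      "\<And>v. v \<in> B \<Longrightarrow> norm v = 1 \<and> (\<exists>c. M *v v = c *\<^sub>R v)"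
    using self_adjoint_orthonormal_eigenbasis[of "(*v) M" UNIV] sym_mat_inner[OF assms]
    by (auto simp: linear_linear)
  have "0 \<notin> B" using B(3) by force
  then have ind: "independent B" using B(1) pairwise_orthogonal_independent by blast
  then have fin: "finite B" by (rule independent_imp_finite)
  have "card B = CARD('n)"
    using ind B(2) by (metis DIM_cart DIM_real dim_UNIV dim_eq_card_independent dim_span
        mult.right_neutral top.extremum_uniqueI)
  then obtain h where h: "bij_betw h (UNIV::'n set) B"
    using fin by (metis bij_betw_iff_card finite_class.finite_UNIV)
  then have hB: "h i \<in> B" for i by (auto simp: bij_betw_def)
  obtain d where d: "M *v h i = d i *\<^sub>R h i" for i
    using B(3)[OF hB] by metis
  define U where "U = (\<chi> k i. h i $ k)"
  have on: "h i \<bullet> h j = (if i = j then 1 else 0)" for i j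
  proof (cases "i = j")
    case True
    then show ?thesis using B(3)[OF hB] by (simp add: dot_square_norm)
  next
    case False
    then have "h i \<noteq> h j" using h by (auto simp: bij_betw_def inj_on_def)
    then show ?thesis using False B(1) hB by (auto simp: pairwise_def orthogonal_def)
  qed
  have "transpose U ** U = mat 1"
    using on by (auto simp: vec_eq_iff matrix_matrix_mult_def transpose_def mat_def U_def inner_vec_def)
  then have U: "orthogonal_matrix U" by (simp add: orthogonal_matrix)
  have "M ** U = U ** diag_mat d"
  proof (simp add: vec_eq_iff, intro allI)
    fix k i
    have "(M ** U) $ k $ i = (M *v h i) $ k"
      by (simp add: matrix_matrix_mult_def matrix_vector_mult_def U_def)
    also have "\<dots> = (U ** diag_mat d) $ k $ i"
      by (simp add: d matrix_matrix_mult_def diag_mat_def U_def if_distrib cong: if_cong)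
    finally show "(M ** U) $ k $ i = (U ** diag_mat d) $ k $ i" .
  qed
  then have "M = U ** diag_mat d ** transpose U"
    using U by (metis matrix_mul_assoc matrix_mul_rid orthogonal_matrix_def)
  with U that show thesis by blast
qed

section \<open>Spectral calculus\<close>

lemma diag_mat_mult_component:
  "(diag_mat d ** W) $ i $ j = d i * W $ i $ j" "(W ** diag_mat d) $ i $ j = W $ i $ j * d j"
  by (simp_all add: diag_mat_def matrix_matrix_mult_def if_distrib if_distribR cong: if_cong)

lemma orthogonal_matrix_cancel:
  fixes U :: "real^'n^'n"
  assumes "orthogonal_matrix U"
  shows "transpose U ** (U ** X) = X" "U ** (transpose U ** X) = X"
    "X ** U ** transpose U = X" "X ** transpose U ** U = X"
proof -
  have "transpose U ** U = mat 1" "U ** transpose U = mat 1"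
    using assms by (auto simp: orthogonal_matrix_def)
  then show "transpose U ** (U ** X) = X" "U ** (transpose U ** X) = X"
    "X ** U ** transpose U = X" "X ** transpose U ** U = X"
    by (metis matrix_mul_assoc matrix_mul_lid matrix_mul_rid)+
qed

text \<open>For \<open>W = transpose U ** V\<close> the matrix equation reads
  \<open>d i * W $ i $ j = W $ i $ j * e j\<close> entrywise. The criterion only compares
  eigenvalues, so it survives applying a scalar function to both; and distinct matrices yield two
  different eigenvalues whose eigenvectors overlap.\<close>

lemma diagonalization_eq_iff:
  fixes U V :: "real^'n^'n"
  assumes U: "orthogonal_matrix U" and V: "orthogonal_matrix V"
  shows "U ** diag_mat d ** transpose U = V ** diag_mat e ** transpose V \<longleftrightarrow>
    (\<forall>i j. (transpose U ** V) $ i $ j \<noteq> 0 \<longrightarrow> d i = e j)"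
proof -
  have "U ** diag_mat d ** transpose U = V ** diag_mat e ** transpose V \<longleftrightarrow>
      diag_mat d ** (transpose U ** V) = (transpose U ** V) ** diag_mat e"
    (is "?L \<longleftrightarrow> ?R")
  proof
    assume ?L
    then have "transpose U ** (U ** diag_mat d ** transpose U) ** V =
        transpose U ** (V ** diag_mat e ** transpose V) ** V"
      by simp
    then show ?R
      using orthogonal_matrix_cancel[OF U] orthogonal_matrix_cancel[OF V]
      by (simp add: matrix_mul_assoc)
  next
    assume ?R
    then have "U ** (diag_mat d ** (transpose U ** V)) ** transpose V =
        U ** ((transpose U ** V) ** diag_mat e) ** transpose V"
      by simp
    then show ?L
      using orthogonal_matrix_cancel[OF U] orthogonal_matrix_cancel[OF V]
      by (metis (no_types, lifting) matrix_mul_assoc)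
  qed
  also have "?R \<longleftrightarrow> (\<forall>i j. (transpose U ** V) $ i $ j \<noteq> 0 \<longrightarrow> d i = e j)"
    by (auto simp: vec_eq_iff diag_mat_mult_component)
  finally show ?thesis .
qed

text \<open>Well-definedness of the spectral calculus: all diagonalizations of a matrix give the
  same value, so the definite description may be evaluated in any of them.\<close>

lemma mat_fun_diagonalization:
  assumes U: "orthogonal_matrix U"
  shows "mat_fun f (U ** diag_mat d ** transpose U) = U ** diag_mat (\<lambda>i. f (d i)) ** transpose U"
  unfolding mat_fun_def
proof (rule the_equality)
  show "\<exists>V e. orthogonal_matrix V \<and> U ** diag_mat d ** transpose U = V ** diag_mat e ** transpose V
      \<and> U ** diag_mat (\<lambda>i. f (d i)) ** transpose U = V ** diag_mat (\<lambda>i. f (e i)) ** transpose V"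
    using U by blast
next
  fix X
  assume "\<exists>V e. orthogonal_matrix V \<and> U ** diag_mat d ** transpose U = V ** diag_mat e ** transpose V
      \<and> X = V ** diag_mat (\<lambda>i. f (e i)) ** transpose V"
  then obtain V e where V: "orthogonal_matrix V"
      and eq: "U ** diag_mat d ** transpose U = V ** diag_mat e ** transpose V"
      and X: "X = V ** diag_mat (\<lambda>i. f (e i)) ** transpose V"
    by blast
  have "\<forall>i j. (transpose U ** V) $ i $ j \<noteq> 0 \<longrightarrow> f (d i) = f (e j)"
    using eq unfolding diagonalization_eq_iff[OF U V] by auto
  then show "X = U ** diag_mat (\<lambda>i. f (d i)) ** transpose U"
    unfolding X diagonalization_eq_iff[OF U V, symmetric] by simp
qed

lemma trace_diagonalization:
  assumes "orthogonal_matrix U"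
  shows "trace (U ** diag_mat d ** transpose U) = (\<Sum>i\<in>UNIV. d i)"
proof -
  have "trace (U ** diag_mat d ** transpose U) = trace (transpose U ** (U ** diag_mat d))"
    by (rule trace_mul_sym)
  also have "\<dots> = trace (diag_mat d)" by (simp add: orthogonal_matrix_cancel[OF assms])
  finally show ?thesis by (simp add: trace_def diag_mat_def)
qed

lemma trace_mat_fun_diagonalization:
  assumes "orthogonal_matrix U"
  shows "trace (mat_fun f (U ** diag_mat d ** transpose U)) = (\<Sum>i\<in>UNIV. f (d i))"
  by (simp add: mat_fun_diagonalization trace_diagonalization assms)

lemma det_diagonalization:
  assumes "orthogonal_matrix U"
  shows "det (U ** diag_mat d ** transpose U) = (\<Prod>i\<in>UNIV. d i)"
proof -
  have "det (U ** diag_mat d ** transpose U) = (det U)\<^sup>2 * det (diag_mat d)"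
    by (simp add: det_mul power2_eq_square mult_ac)
  also have "(det U)\<^sup>2 = 1"
    using det_orthogonal_matrix[OF assms] by auto
  also have "det (diag_mat d) = (\<Prod>i\<in>UNIV. d i)"
    by (subst det_diagonal) (auto simp: diag_mat_def)
  finally show ?thesis by simp
qed

section \<open>Positive definite matrices\<close>

lemma inner_congruence:
  fixes T :: "real^'n^'m"
  shows "x \<bullet> ((T ** M ** transpose T) *v x) = (transpose T *v x) \<bullet> (M *v (transpose T *v x))"
  by (metis dot_lmul_matrix matrix_vector_mul_assoc transpose_matrix_vector)

lemma pos_def_congruence:
  fixes T :: "real^'n^'n"
  assumes "pos_def M" "invertible T"
  shows "pos_def (T ** M ** transpose T)"
proof -
  have "transpose T *v x \<noteq> 0" if "x \<noteq> 0" for x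
    using assms(2) that by (metis invertible_left_inverse matrix_left_invertible_ker transpose_invertible)
  then show ?thesis
    using assms(1) by (auto simp del: transpose_matrix_vector
        simp: pos_def_def sym_mat_def matrix_transpose_mul matrix_mul_assoc inner_congruence)
qed

lemma pos_def_imp_invertible:
  assumes "pos_def M"
  shows "invertible M"
  using assms unfolding invertible_left_inverse matrix_left_invertible_ker pos_def_def
  by (metis inner_zero_right less_irrefl)

lemma diagonalization_component:
  fixes U :: "real^'n^'n"
  shows "(transpose U ** M ** U) $ i $ i = column i U \<bullet> (M *v column i U)"
  by (simp add: inner_vec_def matrix_vector_mult_def matrix_matrix_mult_def column_def transpose_def
      sum_distrib_left sum_distrib_right mult_ac)
     (subst sum.swap, simp add: mult_ac)

lemma eigenvalue_inner:
  fixes U :: "real^'n^'n"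
  assumes "orthogonal_matrix U"
  shows "d i = column i U \<bullet> ((U ** diag_mat d ** transpose U) *v column i U)"
proof -
  have "transpose U ** (U ** diag_mat d ** transpose U) ** U = diag_mat d"
    by (simp add: matrix_mul_assoc[symmetric] orthogonal_matrix_cancel assms)
       (metis assms matrix_mul_rid orthogonal_matrix)
  then show ?thesis unfolding diagonalization_component[symmetric] by (simp add: diag_mat_def)
qed

lemma norm_column_orthogonal_matrix:
  fixes U :: "real^'n^'n"
  assumes "orthogonal_matrix U"
  shows "norm (column i U) = 1"
  using assms by (simp add: orthogonal_matrix_orthonormal_columns)

lemma eigenvalue_pos:
  assumes "orthogonal_matrix U" "pos_def (U ** diag_mat d ** transpose U)"
  shows "d i > 0"
proof -
  have "column i U \<noteq> 0" using norm_column_orthogonal_matrix[OF assms(1), of i] by force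
  then show ?thesis
    using assms eigenvalue_inner[of U d i] by (auto simp: pos_def_def)
qed

lemma pos_def_diagonalization:
  assumes "pos_def M"
  obtains U d where "orthogonal_matrix U" "M = U ** diag_mat d ** transpose U" "\<And>i. d i > 0"
proof -
  obtain U d where "orthogonal_matrix U" "M = U ** diag_mat d ** transpose U"
    using spectral_theorem assms unfolding pos_def_def by blast
  with that eigenvalue_pos assms show thesis by blast
qed

text \<open>Replaces the logarithm by a determinant, whose multiplicativity controls how the case
  \<open>tau = 0\<close> behaves under congruence.\<close>

lemma trace_mat_log:
  assumes "pos_def M"
  shows "trace (mat_log M) = ln (det M)" and "det M > 0"
proof -
  obtain U d where U: "orthogonal_matrix U" "M = U ** diag_mat d ** transpose U" "\<And>i. d i > 0"
    using pos_def_diagonalization[OF assms] by blast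
  show "trace (mat_log M) = ln (det M)"
    using U by (simp add: mat_log_def trace_mat_fun_diagonalization det_diagonalization ln_prod
        less_imp_neq[THEN not_sym])
  show "det M > 0"
    using U by (simp add: det_diagonalization prod_pos)
qed

lemma inner_diagonalization:
  fixes U :: "real^'n^'n"
  shows "x \<bullet> ((U ** diag_mat d ** transpose U) *v x) = (\<Sum>i\<in>UNIV. d i * ((transpose U *v x) $ i)\<^sup>2)"
  unfolding inner_congruence
  by (simp add: inner_vec_def matrix_vector_mult_def diag_mat_def if_distribR if_distrib
      power2_eq_square mult_ac del: transpose_matrix_vector cong: if_cong)

lemma sum_power2_orthogonal_transform:
  fixes U :: "real^'n^'n"
  assumes "orthogonal_matrix U"
  shows "(\<Sum>i\<in>UNIV. ((transpose U *v x) $ i)\<^sup>2) = x \<bullet> x"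
proof -
  have "(\<Sum>i\<in>UNIV. ((transpose U *v x) $ i)\<^sup>2) = (transpose U *v x) \<bullet> (transpose U *v x)"
    by (simp add: inner_vec_def power2_eq_square del: transpose_matrix_vector)
  also have "\<dots> = x \<bullet> x"
    using assms by (metis matrix_vector_mul_assoc matrix_vector_mul_lid orthogonal_matrix_def
        dot_lmul_matrix transpose_matrix_vector transpose_transpose)
  finally show ?thesis .
qed

lemma pos_def_bounds:
  assumes "pos_def M"
  obtains g G where "0 < g" "g \<le> G" "\<And>x. g * (x \<bullet> x) \<le> x \<bullet> (M *v x)"
    "\<And>x. x \<bullet> (M *v x) \<le> G * (x \<bullet> x)"
proof -
  obtain U d where U: "orthogonal_matrix U" "M = U ** diag_mat d ** transpose U" "\<And>i. d i > 0"
    using pos_def_diagonalization[OF assms] by blast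
  define g where "g = Min (range d)"
  define G where "G = Max (range d)"
  have g: "g \<le> d i" "d i \<le> G" for i by (auto simp: g_def G_def)
  have "g > 0" using U(3) by (simp add: g_def)
  moreover have "g \<le> G" using g order_trans by blast
  moreover have "g * (x \<bullet> x) \<le> x \<bullet> (M *v x)" for x
    unfolding U(2) inner_diagonalization sum_power2_orthogonal_transform[OF U(1), symmetric] sum_distrib_left
    by (intro sum_mono mult_right_mono g) auto
  moreover have "x \<bullet> (M *v x) \<le> G * (x \<bullet> x)" for x
    unfolding U(2) inner_diagonalization sum_power2_orthogonal_transform[OF U(1), symmetric] sum_distrib_left
    by (intro sum_mono mult_right_mono g) auto
  ultimately show thesis using that by blast
qed

text \<open>An entry is a sum of \<open>U $ i $ k * d k * U $ j $ k\<close> with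
  \<open>\<bar>U $ i $ k\<bar> \<le> 1\<close> and \<open>d k > 0\<close>, hence at most the trace
  in absolute value. The factor counts the entries. A trace bound thereby becomes
  boundedness.\<close>

lemma norm_le_trace:
  fixes M :: "real^'n^'n"
  assumes "pos_def M"
  shows "norm M \<le> (real CARD('n))\<^sup>2 * trace M"
proof -
  obtain U d where U: "orthogonal_matrix U" "M = U ** diag_mat d ** transpose U" "\<And>i. d i > 0"
    using pos_def_diagonalization[OF assms] by blast
  have U1: "\<bar>U $ i $ k\<bar> \<le> 1" for i k
    using component_le_norm_cart[of "column k U" i] norm_column_orthogonal_matrix[OF U(1), of k]
    by (simp add: column_def)
  have entry: "\<bar>M $ i $ j\<bar> \<le> trace M" for i j
  proof -
    have "M $ i $ j = (\<Sum>k\<in>UNIV. U $ i $ k * d k * U $ j $ k)"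
      unfolding U(2)
      by (subst matrix_matrix_mult_def) (simp add: diag_mat_mult_component transpose_def)
    also have "\<bar>\<dots>\<bar> \<le> (\<Sum>k\<in>UNIV. \<bar>U $ i $ k * d k * U $ j $ k\<bar>)" by (rule sum_abs)
    also have "\<dots> \<le> (\<Sum>k\<in>UNIV. d k)"
    proof (rule sum_mono)
      fix k
      have "\<bar>U $ i $ k\<bar> * \<bar>U $ j $ k\<bar> \<le> 1 * 1" by (intro mult_mono U1) auto
      then have "(\<bar>U $ i $ k\<bar> * \<bar>U $ j $ k\<bar>) * d k \<le> 1 * d k"
        using U(3)[of k] by (intro mult_right_mono) auto
      then show "\<bar>U $ i $ k * d k * U $ j $ k\<bar> \<le> d k"
        using U(3)[of k] by (simp add: abs_mult mult_ac)
    qed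
    also have "\<dots> = trace M" using U by (simp add: trace_diagonalization)
    finally show ?thesis .
  qed
  have "norm M \<le> (\<Sum>i\<in>UNIV. norm (M $ i))"
    by (simp add: norm_vec_def L2_set_le_sum)
  also have "\<dots> \<le> (\<Sum>i\<in>UNIV. \<Sum>j\<in>UNIV. \<bar>M $ i $ j\<bar>)"
    by (intro sum_mono norm_le_l1_cart)
  also have "\<dots> \<le> (\<Sum>i\<in>(UNIV::'n set). \<Sum>j\<in>(UNIV::'n set). trace M)"
    by (intro sum_mono entry)
  finally show ?thesis by (simp add: power2_eq_square)
qed

section \<open>Minimising a convex trace function\<close>

lemma trace_mat_fun_mult:
  fixes U :: "real^'n^'n"
  assumes "orthogonal_matrix U"
  shows "trace (mat_fun g (U ** diag_mat d ** transpose U) ** Z) =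
    (\<Sum>i\<in>UNIV. g (d i) * (column i U \<bullet> (Z *v column i U)))"
proof -
  have "trace (mat_fun g (U ** diag_mat d ** transpose U) ** Z) =
      trace (U ** (diag_mat (\<lambda>i. g (d i)) ** (transpose U ** Z)))"
    by (simp add: mat_fun_diagonalization[OF assms] matrix_mul_assoc)
  also have "\<dots> = trace (diag_mat (\<lambda>i. g (d i)) ** (transpose U ** Z ** U))"
    by (subst trace_mul_sym) (simp add: matrix_mul_assoc)
  finally show ?thesis
    by (simp add: trace_def diag_mat_mult_component diagonalization_component)
qed

section \<open>Linearity of the matrix operations and convex combinations\<close>

lemma trace_scaleR: "trace (c *\<^sub>R (M::real^'n^'n)) = c * trace M"
  by (simp add: trace_def sum_distrib_left)

lemma linear_trace: "linear (trace :: real^'n^'n \<Rightarrow> real)"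
  by (rule linearI) (auto simp: trace_add trace_scaleR)

lemma matrix_mult_scaleR_right: "(M::real^'n^'m) ** (c *\<^sub>R N) = c *\<^sub>R (M ** N)"
  by (simp add: vec_eq_iff matrix_matrix_mult_def sum_distrib_left mult_ac)

lemma linear_matrix_mult_left: "linear (\<lambda>N. (M::real^'n^'m) ** (N::real^'k^'n))"
  by (rule linearI) (auto simp: matrix_add_ldistrib matrix_mult_scaleR_right)

lemma linear_matrix_mult_right: "linear (\<lambda>M. (M::real^'n^'m) ** (N::real^'k^'n))"
  by (rule linearI) (simp_all add: vec_eq_iff matrix_matrix_mult_def sum.distrib distrib_left
      sum_distrib_left mult_ac)

lemma linear_matrix_mult_both:
  "linear (\<lambda>M. (X::real^'k^'l) ** (M::real^'q^'k) ** (Y::real^'p^'q))"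
  using linear_compose[OF linear_matrix_mult_left[of X] linear_matrix_mult_right[of Y]]
  by (simp add: o_def)

lemma inner_affine_combination:
  fixes M N :: "real^'n^'n"
  shows "x \<bullet> ((a *\<^sub>R M + b *\<^sub>R N) *v x) = a * (x \<bullet> (M *v x)) + b * (x \<bullet> (N *v x))"
  by (simp add: matrix_vector_mult_add_rdistrib inner_add_right scaleR_matrix_vector_assoc[symmetric])

lemma sym_mat_affine_combination:
  assumes "sym_mat M" "sym_mat N"
  shows "sym_mat (a *\<^sub>R M + b *\<^sub>R N)"
  using assms by (simp add: sym_mat_def vec_eq_iff transpose_def)

lemma pos_def_convex_combination:
  assumes "pos_def M" "pos_def N" "0 \<le> t" "t \<le> 1"
  shows "pos_def ((1 - t) *\<^sub>R M + t *\<^sub>R N)"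
proof -
  have "0 < x \<bullet> (((1 - t) *\<^sub>R M + t *\<^sub>R N) *v x)" if "x \<noteq> 0" for x
  proof -
    have pos: "0 < x \<bullet> (M *v x)" "0 < x \<bullet> (N *v x)" using assms that by (auto simp: pos_def_def)
    show ?thesis
    proof (cases "t = 0")
      case False
      then have "0 \<le> (1 - t) * (x \<bullet> (M *v x))" "0 < t * (x \<bullet> (N *v x))" using pos assms by auto
      then show ?thesis unfolding inner_affine_combination by linarith
    qed (use pos in simp)
  qed
  then show ?thesis using assms by (simp add: pos_def_def sym_mat_affine_combination)
qed

text \<open>The three conditions on \<open>f'\<close> serve strict convexity, growth for large
  trace, and repulsion from the boundary of the cone. The barrier is imposed on \<open>f'\<close>
  and not on \<open>f\<close>, which stays bounded near 0 for exponents between 0 and 1.\<close>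

locale convex_barrier =
  fixes f f' :: "real \<Rightarrow> real"
  assumes deriv: "x > 0 \<Longrightarrow> (f has_real_derivative f' x) (at x)"
    and deriv_mono: "0 < x \<Longrightarrow> x < y \<Longrightarrow> f' x < f' y"
    and deriv_pos: "\<exists>x>0. f' x > 0"
    and deriv_at_0: "filterlim f' at_bot (at_right 0)"
begin

lemma tangent_less:
  assumes "0 < x" "0 < y" "x \<noteq> y"
  shows "f y + f' y * (x - y) < f x"
proof (cases "x < y")
  case True
  then obtain z where z: "x < z" "z < y" "f y - f x = (y - x) * f' z"
    using MVT2[of x y f f'] deriv assms by force
  have "(y - x) * f' z < (y - x) * f' y"
    using True z assms by (intro mult_strict_left_mono deriv_mono) auto
  then show ?thesis using z(3) by (simp add: algebra_simps)
next
  case False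
  then have "y < x" using assms by simp
  then obtain z where z: "y < z" "z < x" "f x - f y = (x - y) * f' z"
    using MVT2[of y x f f'] deriv assms by force
  have "(x - y) * f' y < (x - y) * f' z"
    using \<open>y < x\<close> z assms by (intro mult_strict_left_mono deriv_mono) auto
  then show ?thesis using z(3) by (simp add: algebra_simps)
qed

lemma tangent_le:
  assumes "0 < x" "0 < y"
  shows "f y + f' y * (x - y) \<le> f x"
  using tangent_less[OF assms] by (cases "x = y") auto

definition tr_fun :: "real^'n^'n \<Rightarrow> real" where
  "tr_fun X = trace (mat_fun f X)"

text \<open>Klein's inequality: in eigenbases of \<open>X\<close> and \<open>Y\<close> the gap is a sum of scalar tangent gaps
  of \<open>f\<close>, weighted by the doubly stochastic matrix of squared inner products.\<close>

lemma klein_identity: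
  fixes U V :: "real^'n^'n"
  assumes U: "orthogonal_matrix U" and V: "orthogonal_matrix V"
    and Y: "Y = U ** diag_mat m ** transpose U" and X: "X = V ** diag_mat l ** transpose V"
  shows "tr_fun X - tr_fun Y - trace (mat_fun f' Y ** (X - Y)) =
    (\<Sum>i\<in>UNIV. \<Sum>j\<in>UNIV. ((transpose U ** V) $ i $ j)\<^sup>2 * (f (l j) - f (m i) - f' (m i) * (l j - m i)))"
proof -
  define w where "w i j = column i U \<bullet> column j V" for i j
  have wW: "(transpose U ** V) $ i $ j = w i j" for i j
    by (simp add: w_def matrix_matrix_mult_def transpose_def column_def inner_vec_def)
  have wV: "(transpose V *v column i U) $ j = w i j" for i j
    by (simp add: w_def matrix_vector_mult_def transpose_def column_def inner_vec_def mult.commute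
        del: transpose_matrix_vector)
  have wU: "(transpose U *v column j V) $ i = w i j" for i j
    by (simp add: w_def matrix_vector_mult_def transpose_def column_def inner_vec_def
        del: transpose_matrix_vector)
  \<comment> \<open>The squared overlaps have row and column sums 1. Inserting these sums as factors
    turns each single sum over eigenvalues into a double sum with common weights.\<close>
  have sum_j: "(\<Sum>j\<in>UNIV. (w i j)\<^sup>2) = 1" for i
    using sum_power2_orthogonal_transform[OF V, of "column i U"] norm_column_orthogonal_matrix[OF U, of i]
    unfolding wV by (simp add: dot_square_norm)
  have sum_i: "(\<Sum>i\<in>UNIV. (w i j)\<^sup>2) = 1" for j
    using sum_power2_orthogonal_transform[OF U, of "column j V"] norm_column_orthogonal_matrix[OF V, of j]
    unfolding wU by (simp add: dot_square_norm)
  have "tr_fun X = (\<Sum>j\<in>UNIV. (\<Sum>i\<in>UNIV. (w i j)\<^sup>2) * f (l j))"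
    by (simp add: tr_fun_def X trace_mat_fun_diagonalization V sum_i)
  also have "\<dots> = (\<Sum>i\<in>UNIV. \<Sum>j\<in>UNIV. (w i j)\<^sup>2 * f (l j))"
    unfolding sum_distrib_right by (rule sum.swap)
  finally have 1: "tr_fun X = (\<Sum>i\<in>UNIV. \<Sum>j\<in>UNIV. (w i j)\<^sup>2 * f (l j))" .
  have "tr_fun Y = (\<Sum>i\<in>UNIV. (\<Sum>j\<in>UNIV. (w i j)\<^sup>2) * f (m i))"
    by (simp add: tr_fun_def Y trace_mat_fun_diagonalization U sum_j)
  then have 2: "tr_fun Y = (\<Sum>i\<in>UNIV. \<Sum>j\<in>UNIV. (w i j)\<^sup>2 * f (m i))"
    unfolding sum_distrib_right .
  have "column i U \<bullet> ((X - Y) *v column i U) = (\<Sum>j\<in>UNIV. (w i j)\<^sup>2 * (l j - m i))" for i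
  proof -
    have "column i U \<bullet> ((X - Y) *v column i U) = (\<Sum>j\<in>UNIV. (w i j)\<^sup>2 * l j) - m i"
      unfolding matrix_vector_mult_diff_rdistrib inner_diff_right X inner_diagonalization wV
      using eigenvalue_inner[OF U, of m i] by (simp add: Y mult.commute)
    also have "m i = (\<Sum>j\<in>UNIV. (w i j)\<^sup>2) * m i" by (simp add: sum_j)
    finally show ?thesis by (simp add: sum_distrib_right sum_subtractf right_diff_distrib)
  qed
  then have 3: "trace (mat_fun f' Y ** (X - Y)) = (\<Sum>i\<in>UNIV. \<Sum>j\<in>UNIV. (w i j)\<^sup>2 * (f' (m i) * (l j - m i)))"
    unfolding Y trace_mat_fun_mult[OF U] by (simp add: sum_distrib_left mult_ac)
  show ?thesis
    unfolding 1 2 3 wW by (simp add: sum_subtractf right_diff_distrib)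
qed

text \<open>All terms of \<open>klein_identity\<close> are nonnegative. Since
  \<open>X \<noteq> Y\<close>, some pair of different eigenvalues has nonzero weight, and its
  tangent gap is strictly positive.\<close>

lemma klein_less:
  assumes "pos_def X" "pos_def Y" "X \<noteq> Y"
  shows "tr_fun Y + trace (mat_fun f' Y ** (X - Y)) < tr_fun X"
proof -
  obtain U m where U: "orthogonal_matrix U" "Y = U ** diag_mat m ** transpose U" "\<And>i. m i > 0"
    using pos_def_diagonalization[OF assms(2)] by blast
  obtain V l where V: "orthogonal_matrix V" "X = V ** diag_mat l ** transpose V" "\<And>i. l i > 0"
    using pos_def_diagonalization[OF assms(1)] by blast
  obtain i j where ij: "(transpose U ** V) $ i $ j \<noteq> 0" "m i \<noteq> l j"
    using assms(3) diagonalization_eq_iff[OF U(1) V(1), of m l] U(2) V(2) by auto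
  let ?g = "\<lambda>i j. ((transpose U ** V) $ i $ j)\<^sup>2 * (f (l j) - f (m i) - f' (m i) * (l j - m i))"
  have nonneg: "?g i j \<ge> 0" for i j
    using tangent_le[OF V(3)[of j] U(3)[of i]] by (intro mult_nonneg_nonneg) auto
  have "0 < ?g i j"
    using tangent_less[OF V(3)[of j] U(3)[of i]] ij by (intro mult_pos_pos) auto
  also have "\<dots> \<le> (\<Sum>j\<in>UNIV. ?g i j)"
    by (rule member_le_sum) (use nonneg in auto)
  also have "\<dots> \<le> (\<Sum>i\<in>UNIV. \<Sum>j\<in>UNIV. ?g i j)"
    by (rule member_le_sum) (use nonneg in \<open>auto intro: sum_nonneg\<close>)
  finally show ?thesis
    using klein_identity[OF U(1) V(1) U(2) V(2)] by linarith
qed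

lemma klein_le:
  assumes "pos_def X" "pos_def Y"
  shows "tr_fun Y + trace (mat_fun f' Y ** (X - Y)) \<le> tr_fun X"
proof (cases "X = Y")
  case True
  then show ?thesis by (simp add: trace_def matrix_matrix_mult_def)
qed (use klein_less[OF assms] in simp)

text \<open>Apply Klein's inequality at the midpoint \<open>Z\<close> to both \<open>P\<close> and
  \<open>Q\<close>. The displacements \<open>P - Z\<close> and \<open>Q - Z\<close> are opposite, so
  the gradient terms cancel in the sum and \<open>Z\<close> beats the average of two minima.\<close>

lemma tr_fun_minimizer_unique:
  fixes P Q :: "real^'n^'n"
  assumes K: "convex K" and P: "pos_def P" "P \<in> K" and Q: "pos_def Q" "Q \<in> K"
    and minP: "\<And>X. pos_def X \<Longrightarrow> X \<in> K \<Longrightarrow> tr_fun P \<le> tr_fun X"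
    and minQ: "\<And>X. pos_def X \<Longrightarrow> X \<in> K \<Longrightarrow> tr_fun Q \<le> tr_fun X"
  shows "P = Q"
proof (rule ccontr)
  assume "P \<noteq> Q"
  define Z where "Z = (1 - 1/2) *\<^sub>R P + (1/2) *\<^sub>R Q"
  have Z: "pos_def Z" unfolding Z_def by (intro pos_def_convex_combination P Q) auto
  have ZK: "Z \<in> K" unfolding Z_def by (rule convexD_alt[OF K P(2) Q(2)]) auto
  have PZ: "P - Z = (1/2) *\<^sub>R (P - Q)" and QZ: "Q - Z = (-1/2) *\<^sub>R (P - Q)"
    by (simp_all add: Z_def vec_eq_iff field_simps)
  have "P \<noteq> Z" using PZ \<open>P \<noteq> Q\<close> by auto
  from klein_less[OF P(1) Z this] klein_le[OF Q(1) Z]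
  have "2 * tr_fun Z < tr_fun P + tr_fun Q"
    unfolding PZ QZ matrix_mult_scaleR_right trace_scaleR by linarith
  then show False using minP[OF Z ZK] minQ[OF Z ZK] by linarith
qed

text \<open>The scalar tangent inequality at \<open>a\<close>, summed over the eigenvalues. For
  \<open>f' a > 0\<close> it bounds the trace on sublevel sets.\<close>

lemma tr_fun_coercive:
  fixes X :: "real^'n^'n"
  assumes X: "pos_def X" and a: "a > 0"
  shows "real CARD('n) * (f a - f' a * a) + f' a * trace X \<le> tr_fun X"
proof -
  obtain U d where U: "orthogonal_matrix U" "X = U ** diag_mat d ** transpose U" "\<And>i. d i > 0"
    using pos_def_diagonalization[OF X] by blast
  have "(\<Sum>i\<in>(UNIV::'n set). f a + f' a * (d i - a)) \<le> (\<Sum>i\<in>UNIV. f (d i))"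
    by (intro sum_mono tangent_le U a)
  then show ?thesis
    by (simp add: U tr_fun_def trace_mat_fun_diagonalization trace_diagonalization sum.distrib
        right_diff_distrib sum_subtractf sum_distrib_left)
qed

text \<open>Moving a nearly singular \<open>P\<close> a fixed distance towards \<open>G\<close> does not increase the trace
  function: the gradient at the new point is dominated by the smallest eigenvalue, where the
  derivative of \<open>f\<close> is very negative.\<close>

lemma tr_fun_push_inside:
  fixes G :: "real^'n^'n"
  assumes G: "pos_def G" and R: "trace G \<le> R"
  obtains t e where "0 < t" "t < 1" "0 < e"
    "\<And>P x. pos_def P \<Longrightarrow> trace P \<le> R \<Longrightarrow> x \<bullet> (P *v x) < e * (x \<bullet> x) \<Longrightarrow>
       tr_fun ((1 - t) *\<^sub>R P + t *\<^sub>R G) \<le> tr_fun P"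
proof -
  obtain g H where g: "0 < g" "g \<le> H" "\<And>x. g * (x \<bullet> x) \<le> x \<bullet> (G *v x)"
    "\<And>x. x \<bullet> (G *v x) \<le> H * (x \<bullet> x)"
    using pos_def_bounds[OF G] by metis
  \<comment> \<open>\<open>C\<close> bounds \<open>\<bar>f' (c i) * (m i - c i)\<bar>\<close> below,
    where \<open>c i\<close> lies in \<open>[g, H]\<close> and the eigenvalue \<open>m i\<close> in
    \<open>(0, \<bar>R\<bar>]\<close>.\<close>
  define C where "C = (\<bar>f' g\<bar> + \<bar>f' H\<bar>) * (\<bar>R\<bar> + H)"
  have C0: "C \<ge> 0" using g by (simp add: C_def)
  define N where "N = real CARD('n)"
  \<comment> \<open>The threshold is chosen so that its product with \<open>g / 2\<close> is
    \<open>N * C\<close>: one small eigenvalue then outweighs the other \<open>N - 1\<close> terms,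
    each at least \<open>- C\<close>.\<close>
  have "eventually (\<lambda>x. f' x \<le> - (2 * N * C / g)) (at_right 0)"
    using deriv_at_0 by (simp add: filterlim_at_bot)
  then obtain b where b: "b > 0" "\<And>x. 0 < x \<Longrightarrow> x < b \<Longrightarrow> f' x \<le> - (2 * N * C / g)"
    by (auto simp: eventually_at_right_field)
  \<comment> \<open>An eigenvalue at most \<open>s\<close> is below \<open>b\<close>, where
    \<open>f'\<close> is very negative, and at distance at least \<open>g / 2\<close> from every
    number above \<open>g\<close>.\<close>
  define s where "s = min (b / 2) (g / 2)"
  have s: "s > 0" "s < b" "s \<le> g / 2" using b(1) g(1) by (auto simp: s_def)
  \<comment> \<open>With \<open>t * H \<le> s / 2\<close>, mixing in \<open>G\<close> adds at most
    \<open>s / 2\<close> to the quadratic form on unit vectors, so a direction where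
    \<open>P\<close> is below \<open>s / 2\<close> stays below \<open>s\<close>.\<close>
  define t where "t = min (1 / 2) (s / (2 * H))"
  have t: "0 < t" "t < 1" and tH: "t * H \<le> s / 2"
  proof -
    have "H > 0" using g by linarith
    then show "0 < t" "t < 1" using s by (auto simp: t_def)
    have "t * H \<le> s / (2 * H) * H" using \<open>H > 0\<close> by (intro mult_right_mono) (auto simp: t_def)
    then show "t * H \<le> s / 2" using \<open>H > 0\<close> by simp
  qed
  have "tr_fun ((1 - t) *\<^sub>R P + t *\<^sub>R G) \<le> tr_fun P"
    if P: "pos_def P" "trace P \<le> R" "x \<bullet> (P *v x) < s / 2 * (x \<bullet> x)" for P x
  proof -
    define Y where "Y = (1 - t) *\<^sub>R P + t *\<^sub>R G"
    have Y: "pos_def Y" unfolding Y_def using t by (intro pos_def_convex_combination P G) auto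
    obtain U m where U: "orthogonal_matrix U" "Y = U ** diag_mat m ** transpose U" "\<And>i. m i > 0"
      using pos_def_diagonalization[OF Y] by blast
    have "(1 - t) * trace P + t * trace G \<le> (1 - t) * R + t * R"
      using t P R by (intro add_mono mult_left_mono) auto
    then have trY: "trace Y \<le> R"
      unfolding Y_def trace_add trace_scaleR by (simp add: algebra_simps)
    have mR: "m i \<le> \<bar>R\<bar>" for i
    proof -
      have "m i \<le> (\<Sum>i\<in>UNIV. m i)"
        by (rule member_le_sum) (use U(3) in \<open>auto intro: less_imp_le\<close>)
      also have "\<dots> = trace Y" using U by (simp add: trace_diagonalization)
      finally show ?thesis using trY by linarith
    qed
    define c where "c i = column i U \<bullet> (G *v column i U)" for i
    have c: "g \<le> c i" "c i \<le> H" for i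
      using g(3,4)[of "column i U"] norm_column_orthogonal_matrix[OF U(1), of i]
      by (auto simp: c_def dot_square_norm)
    \<comment> \<open>By monotonicity of \<open>f'\<close>, the factor \<open>f' (m i)\<close>,
      unbounded as \<open>m i\<close> tends to 0, may be replaced by \<open>f' (c i)\<close> with
      \<open>c i\<close> confined to \<open>[g, H]\<close>.\<close>
    have term_ge: "- C \<le> f' (m i) * (m i - c i)" for i
    proof -
      have mono: "f' x \<le> f' y" if "0 < x" "x \<le> y" for x y
        using deriv_mono[of x y] that by (cases "x = y") auto
      have c0: "c i > 0" using c[of i] g by linarith
      have "0 \<le> (f' (m i) - f' (c i)) * (m i - c i)"
        using mono[of "m i" "c i"] mono[of "c i" "m i"] U(3)[of i] c0
        by (cases "m i \<le> c i") (auto intro: mult_nonneg_nonneg mult_nonpos_nonpos)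
      then have "f' (c i) * (m i - c i) \<le> f' (m i) * (m i - c i)"
        by (simp add: algebra_simps)
      moreover have "\<bar>f' (c i) * (m i - c i)\<bar> \<le> C"
        unfolding abs_mult C_def
      proof (rule mult_mono)
        show "\<bar>f' (c i)\<bar> \<le> \<bar>f' g\<bar> + \<bar>f' H\<bar>"
          using mono[of g "c i"] mono[of "c i" H] c[of i] g c0 by linarith
        show "\<bar>m i - c i\<bar> \<le> \<bar>R\<bar> + H"
          using mR[of i] U(3)[of i] c[of i] c0 g by linarith
      qed auto
      ultimately show ?thesis by linarith
    qed
    \<comment> \<open>Otherwise the quadratic form of \<open>Y\<close> would be at least
      \<open>s\<close> on unit vectors, contradicting its size in the direction
      \<open>x\<close>.\<close>
    have "\<exists>k. m k \<le> s"
    proof (rule ccontr)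
      assume "\<not> (\<exists>k. m k \<le> s)"
      then have "s \<le> m k" for k by (meson less_imp_le not_less)
      then have "s * (x \<bullet> x) \<le> x \<bullet> (Y *v x)"
        unfolding U(2) inner_diagonalization sum_power2_orthogonal_transform[OF U(1), symmetric] sum_distrib_left
        by (intro sum_mono mult_right_mono) auto
      also have "\<dots> = (1 - t) * (x \<bullet> (P *v x)) + t * (x \<bullet> (G *v x))"
        by (simp add: Y_def inner_affine_combination)
      also have "\<dots> < s / 2 * (x \<bullet> x) + s / 2 * (x \<bullet> x)"
      proof (rule add_less_le_mono)
        have "0 \<le> x \<bullet> (P *v x)" using P(1) by (cases "x = 0") (auto simp: pos_def_def less_imp_le)
        then have "(1 - t) * (x \<bullet> (P *v x)) \<le> 1 * (x \<bullet> (P *v x))"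
          using t by (intro mult_right_mono) auto
        then show "(1 - t) * (x \<bullet> (P *v x)) < s / 2 * (x \<bullet> x)" using P(3) by linarith
        have "t * (x \<bullet> (G *v x)) \<le> t * (H * (x \<bullet> x))" using t g by (intro mult_left_mono) auto
        also have "\<dots> = t * H * (x \<bullet> x)" by simp
        also have "\<dots> \<le> s / 2 * (x \<bullet> x)" using tH by (intro mult_right_mono) auto
        finally show "t * (x \<bullet> (G *v x)) \<le> s / 2 * (x \<bullet> x)" .
      qed
      finally show False by simp
    qed
    then obtain k where k: "m k \<le> s" by blast
    have "(2 * N * C / g) * (g / 2) \<le> (- f' (m k)) * (c k - m k)"
    proof (rule mult_mono)
      show "2 * N * C / g \<le> - f' (m k)" using b(2)[of "m k"] U(3)[of k] k s by linarith
      show "g / 2 \<le> c k - m k" using c[of k] k s by linarith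
      have "0 \<le> 2 * N * C / g" using C0 g by (simp add: N_def)
      then show "0 \<le> - f' (m k)" using \<open>2 * N * C / g \<le> - f' (m k)\<close> by linarith
    qed (use g in auto)
    then have big: "N * C \<le> f' (m k) * (m k - c k)" using g by (simp add: algebra_simps)
    have "(\<Sum>i\<in>UNIV - {k}. - C) \<le> (\<Sum>i\<in>UNIV - {k}. f' (m i) * (m i - c i))"
      by (intro sum_mono term_ge)
    moreover have "(\<Sum>i\<in>UNIV - {k}. - C) = - (N - 1) * C"
      by (simp add: N_def card_Diff_singleton of_nat_diff Suc_leI algebra_simps)
    moreover have "(\<Sum>i\<in>UNIV. f' (m i) * (m i - c i)) =
        f' (m k) * (m k - c k) + (\<Sum>i\<in>UNIV - {k}. f' (m i) * (m i - c i))"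
      by (rule sum.remove) auto
    moreover have "N * C - (N - 1) * C \<ge> 0" using C0 by (simp add: algebra_simps)
    ultimately have grad: "0 \<le> (\<Sum>i\<in>UNIV. f' (m i) * (m i - c i))"
      using big by linarith
    \<comment> \<open>\<open>Y\<close> lies between \<open>P\<close> and \<open>G\<close>, so the
      derivative at \<open>Y\<close> towards \<open>P\<close> has the sign of the one along
      \<open>Y - G\<close>, which the eigenvalue estimate controls.\<close>
    have "P - Y = (t / (1 - t)) *\<^sub>R (Y - G)"
    proof -
      have "(1 - t) *\<^sub>R (P - Y) = t *\<^sub>R (Y - G)"
        by (simp add: Y_def algebra_simps)
      then have "(1 / (1 - t)) *\<^sub>R ((1 - t) *\<^sub>R (P - Y)) = (1 / (1 - t)) *\<^sub>R (t *\<^sub>R (Y - G))" by simp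
      then show ?thesis using t by simp
    qed
    then have "trace (mat_fun f' Y ** (P - Y)) = t / (1 - t) * trace (mat_fun f' Y ** (Y - G))"
      by (simp add: matrix_mult_scaleR_right trace_scaleR)
    also have "trace (mat_fun f' Y ** (Y - G)) = (\<Sum>i\<in>UNIV. f' (m i) * (m i - c i))"
    proof -
      have "column i U \<bullet> ((Y - G) *v column i U) = m i - c i" for i
        using eigenvalue_inner[OF U(1), of m i]
        by (simp add: matrix_vector_mult_diff_rdistrib inner_diff_right c_def U(2))
      then show ?thesis using trace_mat_fun_mult[OF U(1), of f' m "Y - G"] U(2) by simp
    qed
    finally have "0 \<le> trace (mat_fun f' Y ** (P - Y))" using grad t by simp
    then show ?thesis using klein_le[OF P(1) Y] by (simp add: Y_def)
  qed
  then show thesis using that[of t "s / 2"] t s by auto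
qed

text \<open>Klein's inequality at the limit \<open>P\<close> of a minimising subsequence bounds
  \<open>tr_fun\<close> from below by an affine function that agrees with it at \<open>P\<close>.
  This gives the lower semicontinuity required, without proving continuity of the spectral
  calculus.\<close>

lemma tr_fun_attains_min_on_compact:
  fixes C :: "(real^'n^'n) set"
  assumes C: "compact C" "C \<noteq> {}" and pos: "\<And>X. X \<in> C \<Longrightarrow> pos_def X"
  obtains P where "P \<in> C" "\<And>X. X \<in> C \<Longrightarrow> tr_fun P \<le> tr_fun X"
proof -
  obtain a where a: "a > 0" "f' a > 0" using deriv_pos by blast
  have trace_nonneg: "0 \<le> trace X" if "X \<in> C" for X
    using norm_le_trace[OF pos[OF that]] norm_ge_zero[of X]
    by (smt (verit) mult_nonneg_nonpos zero_le_power2 zero_less_card_finite mult_pos_neg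
        of_nat_0_less_iff zero_less_power)
  have bdd: "bdd_below (tr_fun ` C)"
  proof (rule bdd_belowI2)
    fix X assume "X \<in> C"
    then show "real CARD('n) * (f a - f' a * a) \<le> tr_fun X"
      using tr_fun_coercive[OF pos a(1)] trace_nonneg a(2) by (smt (verit) mult_nonneg_nonneg)
  qed
  define I where "I = Inf (tr_fun ` C)"
  have "\<exists>X\<in>C. tr_fun X < I + 1 / (real k + 1)" for k :: nat
  proof -
    have "Inf (tr_fun ` C) < I + 1 / (real k + 1)" by (simp add: I_def)
    from cInf_lessD[OF _ this] C(2) show ?thesis by auto
  qed
  then obtain X where X: "\<And>k. X k \<in> C" "\<And>k. tr_fun (X k) < I + 1 / (real k + 1)"
    by metis
  obtain P r where P: "P \<in> C" "strict_mono r" "(X \<circ> r) \<longlonglongrightarrow> P"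
    using seq_compactE[of C X] C(1) X(1) unfolding compact_eq_seq_compact_metric by metis
  have "(\<lambda>k. trace (mat_fun f' P ** (X (r k) - P))) \<longlonglongrightarrow> trace (mat_fun f' P ** (P - P))"
    using P(3) linear_compose[OF linear_matrix_mult_left linear_trace, of "mat_fun f' P"]
    by (intro bounded_linear.tendsto[of "\<lambda>Z. trace (mat_fun f' P ** Z)"] tendsto_diff tendsto_const)
       (auto simp: linear_conv_bounded_linear o_def)
  moreover have "trace (mat_fun f' P ** (P - P)) = 0"
    by (simp add: trace_def matrix_matrix_mult_def)
  ultimately have "(\<lambda>k. tr_fun P + trace (mat_fun f' P ** (X (r k) - P))) \<longlonglongrightarrow> tr_fun P + 0"
    by (intro tendsto_add tendsto_const) simp
  moreover have "(\<lambda>k. I + 1 / (real (r k) + 1)) \<longlonglongrightarrow> I + 0"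
  proof (intro tendsto_add tendsto_const)
    have "(\<lambda>k. 1 / (real k + 1)) \<longlonglongrightarrow> 0"
      using LIMSEQ_inverse_real_of_nat by (simp add: inverse_eq_divide add.commute)
    from LIMSEQ_subseq_LIMSEQ[OF this P(2)] show "(\<lambda>k. 1 / (real (r k) + 1)) \<longlonglongrightarrow> 0"
      by (simp add: o_def)
  qed
  moreover have "tr_fun P + trace (mat_fun f' P ** (X (r k) - P)) \<le> I + 1 / (real (r k) + 1)" for k
    using klein_le[OF pos[OF X(1)] pos[OF P(1)], of "r k"] X(2)[of "r k"] by linarith
  ultimately have "tr_fun P + 0 \<le> I + 0"
    by (intro LIMSEQ_le[of _ _ _ "I + 0"]) auto
  then have "tr_fun P \<le> tr_fun X" if "X \<in> C" for X
    using cInf_lower[OF _ bdd, of "tr_fun X"] that by (auto simp: I_def)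
  then show thesis using that P(1) by blast
qed

text \<open>Every competitor is matched by a point of the compact set \<open>C\<close>: one worse
  than \<open>G\<close> by \<open>G\<close> itself, one with smallest eigenvalue at least
  \<open>e\<close> by itself, and any other by its image under the push towards
  \<open>G\<close>.\<close>

lemma tr_fun_minimizer_exists:
  fixes K :: "(real^'n^'n) set"
  assumes K: "convex K" "closed K" and G: "pos_def G" "G \<in> K"
  obtains P where "pos_def P" "P \<in> K" "\<And>X. pos_def X \<Longrightarrow> X \<in> K \<Longrightarrow> tr_fun P \<le> tr_fun X"
proof -
  obtain a where a: "a > 0" "f' a > 0" using deriv_pos by blast
  \<comment> \<open>The second entry is the trace bound that coercivity gives for points no worse
    than \<open>G\<close>; the first ensures that \<open>G\<close>, and mixtures with
    \<open>G\<close>, obey the same bound.\<close>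
  define R where "R = max (trace G) ((tr_fun G - real CARD('n) * (f a - f' a * a)) / f' a)"
  obtain t e where t: "0 < t" "t < 1" "0 < e"
    and push: "\<And>P x. pos_def P \<Longrightarrow> trace P \<le> R \<Longrightarrow> x \<bullet> (P *v x) < e * (x \<bullet> x) \<Longrightarrow>
       tr_fun ((1 - t) *\<^sub>R P + t *\<^sub>R G) \<le> tr_fun P"
    using tr_fun_push_inside[OF G(1), of R] by (auto simp: R_def)
  obtain g where g: "0 < g" "\<And>x. g * (x \<bullet> x) \<le> x \<bullet> (G *v x)"
    using pos_def_bounds[OF G(1)] by metis
  \<comment> \<open>\<open>e\<close> is the lower bound for points that need no push,
    \<open>t * g\<close> the one inherited by a pushed point from its share \<open>t\<close> of
    \<open>G\<close>.\<close>
  define h where "h = min e (t * g)"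
  have h: "0 < h" "h \<le> e" "h \<le> t * g" "h \<le> g"
    using t g mult_right_mono[of t 1 g] by (auto simp: h_def intro: min.coboundedI2)
  define C where "C = {X \<in> K. sym_mat X \<and> (\<forall>x. h * (x \<bullet> x) \<le> x \<bullet> (X *v x)) \<and> trace X \<le> R}"
  have pos: "pos_def X" if "X \<in> C" for X
  proof -
    have "0 < x \<bullet> (X *v x)" if "x \<noteq> 0" for x
    proof -
      have "0 < h * (x \<bullet> x)" using h(1) that by simp
      also have "\<dots> \<le> x \<bullet> (X *v x)" using \<open>X \<in> C\<close> by (simp add: C_def)
      finally show ?thesis .
    qed
    then show ?thesis using that by (simp add: C_def pos_def_def)
  qed
  have "closed C"
  proof -
    have cont: "continuous_on UNIV (\<lambda>X::real^'n^'n. x \<bullet> (X *v x))" for x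
      by (simp add: inner_vec_def matrix_vector_mult_def) (intro continuous_intros)
    \<comment> \<open>Positive definiteness is not a closed condition; the uniform bound by
      \<open>h\<close> is, as an intersection of nonstrict inequalities.\<close>
    have "C = K \<inter> (\<Inter>i j. {X. X $ i $ j = X $ j $ i}) \<inter> (\<Inter>x. {X. h * (x \<bullet> x) \<le> x \<bullet> (X *v x)}) \<inter> {X. trace X \<le> R}"
      by (auto simp: C_def sym_mat_def transpose_def vec_eq_iff)
    also have "closed \<dots>"
      using K(2) linear_trace
      by (intro closed_Int closed_INT ballI closed_Collect_eq closed_Collect_le cont
          continuous_intros linear_continuous_on) (auto simp: linear_conv_bounded_linear)
    finally show ?thesis .
  qed
  moreover have "bounded C"
  proof (rule boundedI)
    fix X assume "X \<in> C"
    then have "norm X \<le> (real CARD('n))\<^sup>2 * trace X" by (intro norm_le_trace pos)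
    also have "\<dots> \<le> (real CARD('n))\<^sup>2 * R"
      using \<open>X \<in> C\<close> by (intro mult_left_mono) (auto simp: C_def)
    finally show "norm X \<le> (real CARD('n))\<^sup>2 * R" .
  qed
  ultimately have "compact C" by (simp add: compact_eq_bounded_closed)
  have GC: "G \<in> C"
  proof -
    have "h * (x \<bullet> x) \<le> x \<bullet> (G *v x)" for x
      using mult_right_mono[OF h(4), of "x \<bullet> x"] g(2)[of x] by simp
    then show ?thesis using G by (auto simp: C_def R_def pos_def_def)
  qed
  with \<open>compact C\<close> pos obtain P where P: "P \<in> C" "\<And>X. X \<in> C \<Longrightarrow> tr_fun P \<le> tr_fun X"
    using tr_fun_attains_min_on_compact[of C] by blast
  have "tr_fun P \<le> tr_fun X" if X: "pos_def X" "X \<in> K" for X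
  proof (cases "tr_fun X \<le> tr_fun G")
    case False
    then show ?thesis using P(2)[OF GC] by simp
  next
    case True
    have "f' a * trace X \<le> tr_fun G - real CARD('n) * (f a - f' a * a)"
      using tr_fun_coercive[OF X(1) a(1)] True by linarith
    then have "trace X \<le> (tr_fun G - real CARD('n) * (f a - f' a * a)) / f' a"
      using a by (simp add: field_simps)
    then have trX: "trace X \<le> R" by (simp add: R_def)
    show ?thesis
    proof (cases "\<exists>x. x \<bullet> (X *v x) < e * (x \<bullet> x)")
      case False
      have "h * (x \<bullet> x) \<le> x \<bullet> (X *v x)" for x
      proof -
        have "h * (x \<bullet> x) \<le> e * (x \<bullet> x)" using h by (intro mult_right_mono) auto
        also have "\<dots> \<le> x \<bullet> (X *v x)" using False by (simp add: not_less)
        finally show ?thesis .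
      qed
      then have "X \<in> C" using X trX by (simp add: C_def pos_def_def)
      then show ?thesis by (rule P(2))
    next
      case True
      define Y where "Y = (1 - t) *\<^sub>R X + t *\<^sub>R G"
      have "tr_fun Y \<le> tr_fun X" unfolding Y_def using push[OF X(1) trX] True by blast
      moreover have "Y \<in> C"
      proof -
        have "Y \<in> K" unfolding Y_def by (rule convexD_alt[OF K(1) X(2) G(2)]) (use t in auto)
        moreover have "sym_mat Y"
          unfolding Y_def using X G by (intro sym_mat_affine_combination) (auto simp: pos_def_def)
        moreover have "h * (x \<bullet> x) \<le> x \<bullet> (Y *v x)" for x
        proof -
          have "h * (x \<bullet> x) \<le> t * g * (x \<bullet> x)" using h by (intro mult_right_mono) auto
          also have "\<dots> = t * (g * (x \<bullet> x))" by simp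
          also have "\<dots> \<le> t * (x \<bullet> (G *v x))" using t g(2) by (intro mult_left_mono) auto
          also have "\<dots> \<le> (1 - t) * (x \<bullet> (X *v x)) + t * (x \<bullet> (G *v x))"
          proof -
            have "0 \<le> x \<bullet> (X *v x)" using X(1) by (cases "x = 0") (auto simp: pos_def_def less_imp_le)
            then show ?thesis using t by simp
          qed
          finally show ?thesis by (simp add: Y_def inner_affine_combination)
        qed
        moreover have "trace Y \<le> R"
        proof -
          have "(1 - t) * trace X + t * trace G \<le> (1 - t) * R + t * R"
            using t trX by (intro add_mono mult_left_mono) (auto simp: R_def)
          then show ?thesis unfolding Y_def trace_add trace_scaleR by (simp add: algebra_simps)
        qed
        ultimately show ?thesis by (simp add: C_def)
      qed
      ultimately show ?thesis using P(2) by fastforce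
    qed
  qed
  then show thesis using that[of P] P(1) pos by (auto simp: C_def)
qed

end

section \<open>The Cholesky factor\<close>

text \<open>Gram-Schmidt along the order of the index type: \<open>q i\<close> is the normalised
  component of \<open>v i\<close> orthogonal to the span of the earlier vectors.\<close>

lemma orthonormal_triangularization:
  fixes v :: "'n::{finite,linorder} \<Rightarrow> (real, 'n) vec"
  assumes indep: "\<And>i. v i \<notin> span (v ` {..<i})"
  obtains q where "orthogonal_matrix (\<chi> i. q i)" "\<And>i j. i < j \<Longrightarrow> v i \<bullet> q j = 0" "\<And>i. v i \<bullet> q i > 0"
proof -
  have "\<exists>z. v i - z \<in> span (v ` {..<i}) \<and> (\<forall>w\<in>span (v ` {..<i}). z \<bullet> w = 0)" for i
  proof -
    obtain y z where "y \<in> span (v ` {..<i})" "\<And>w. w \<in> span (v ` {..<i}) \<Longrightarrow> orthogonal z w" "v i = y + z"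
      using orthogonal_subspace_decomp_exists[of "v ` {..<i}" "v i"] by blast
    then show ?thesis by (intro exI[of _ z]) (auto simp: orthogonal_def)
  qed
  then obtain z where z: "\<And>i. v i - z i \<in> span (v ` {..<i})"
      "\<And>i w. w \<in> span (v ` {..<i}) \<Longrightarrow> z i \<bullet> w = 0"
    by metis
  have z0: "z i \<noteq> 0" for i using z(1)[of i] indep[of i] by auto
  have v_in: "v i \<in> span (v ` {..<j})" if "i < j" for i j
    using that by (auto intro: span_base)
  have z_in: "z i \<in> span (v ` {..<j})" if "i < j" for i j
  proof -
    have "span (v ` {..<i}) \<subseteq> span (v ` {..<j})" using that by (intro span_mono) auto
    then show ?thesis
      using span_diff[OF v_in[OF that], of "v i - z i"] z(1)[of i] by auto
  qed
  have z_orth: "z i \<bullet> z j = 0" if "i \<noteq> j" for i j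
    using that z(2)[OF z_in, of i j] z(2)[OF z_in, of j i]
    by (cases "i < j") (auto simp: inner_commute)
  define q where "q i = (1 / norm (z i)) *\<^sub>R z i" for i
  have "orthogonal_matrix (\<chi> i. q i)"
    unfolding orthogonal_matrix_orthonormal_rows row_def
    using z0 z_orth by (simp add: q_def orthogonal_def vec_lambda_eta)
  moreover have "v i \<bullet> q j = 0" if "i < j" for i j
    using z(2)[OF v_in[OF that]] by (simp add: q_def inner_commute)
  moreover have "v i \<bullet> q i > 0" for i
  proof -
    have "v i \<bullet> z i = z i \<bullet> (v i - z i) + z i \<bullet> z i" by (simp add: inner_diff_right inner_commute)
    also have "\<dots> = z i \<bullet> z i" using z by simp
    finally show ?thesis using z0[of i] by (simp add: q_def)
  qed
  ultimately show thesis using that by blast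
qed

text \<open>Write \<open>Q = transpose M ** M\<close> with \<open>M\<close> built from the square
  roots of the eigenvalues, and orthonormalise the columns \<open>v i\<close> of \<open>M\<close>.
  The coefficients \<open>v i \<bullet> q j\<close> form the factor, the orthogonal part cancelling
  in \<open>L ** transpose L\<close>.\<close>

lemma cholesky_exists:
  fixes Q :: "('n::{finite,linorder}) rmat"
  assumes "pos_def Q"
  shows "\<exists>L. lower_triangular L \<and> (\<forall>i. L $ i $ i > 0) \<and> Q = L ** transpose L"
proof -
  obtain U d where U: "orthogonal_matrix U" "Q = U ** diag_mat d ** transpose U" "\<And>i. d i > 0"
    using pos_def_diagonalization[OF assms] by blast
  define D where "D = (diag_mat (\<lambda>i. sqrt (d i)) :: 'n rmat)"
  define M where "M = D ** transpose U"
  have DD: "D ** D = diag_mat d"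
    unfolding D_def by (simp add: vec_eq_iff diag_mat_mult_component)
      (use U(3) in \<open>auto simp: diag_mat_def less_imp_le\<close>)
  have "transpose D = D"
    by (auto simp: D_def diag_mat_def transpose_def vec_eq_iff)
  then have MM: "transpose M ** M = Q"
    by (simp add: M_def U(2) DD[symmetric] matrix_transpose_mul matrix_mul_assoc)
  have inj: "inj ((*v) M)"
    using MM pos_def_imp_invertible[OF assms]
    by (metis invertible_left_inverse matrix_left_invertible_injective matrix_mul_assoc)
  define v where "v i = M *v axis i 1" for i :: 'n
  have "v i \<notin> span (v ` {..<i})" for i
  proof
    assume "v i \<in> span (v ` {..<i})"
    also have "v ` {..<i} = (*v) M ` ((\<lambda>j. axis j 1) ` {..<i})"
      by (simp add: v_def image_image)
    also have "span \<dots> = (*v) M ` span ((\<lambda>j. axis j 1) ` {..<i})"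
      by (rule linear_span_image) simp
    finally have "axis i 1 \<in> span ((\<lambda>j. axis j 1 :: (real, 'n) vec) ` {..<i})"
      using inj by (auto simp: v_def inj_def)
    moreover have "span ((\<lambda>j. axis j 1 :: (real, 'n) vec) ` {..<i}) \<subseteq> {x. x $ i = 0}"
      by (rule span_minimal) (auto simp: subspace_def axis_def)
    ultimately show False by (auto simp: axis_def)
  qed
  then obtain q where q: "orthogonal_matrix (\<chi> i. q i)" "\<And>i j. i < j \<Longrightarrow> v i \<bullet> q j = 0"
      "\<And>i. v i \<bullet> q i > 0"
    using orthonormal_triangularization[of v] by blast
  define Z where "Z = (\<chi> i. q i)"
  define L where "L = transpose M ** transpose Z"
  have L: "L $ i $ j = v i \<bullet> q j" for i j
    by (simp add: L_def Z_def v_def matrix_matrix_mult_def transpose_def inner_vec_def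
        matrix_vector_mult_def axis_def if_distrib if_distribR cong: if_cong)
  have "Q = L ** transpose L"
    using MM orthogonal_matrix_cancel(4)[OF q(1)]
    by (simp add: L_def Z_def matrix_transpose_mul matrix_mul_assoc)
  then show ?thesis using q L by (intro exI[of _ L]) (simp add: lower_triangular_def)
qed

text \<open>Column \<open>j\<close> of the product involves only columns up to \<open>j\<close>.
  Once the earlier ones agree, the diagonal entry is fixed up to sign, hence fixed by positivity,
  and the rest of the column follows by division.\<close>

lemma cholesky_unique:
  fixes L L' :: "('n::{finite,linorder}) rmat"
  assumes L: "lower_triangular L" "\<And>i. L $ i $ i > 0"
    and L': "lower_triangular L'" "\<And>i. L' $ i $ i > 0"
    and eq: "L ** transpose L = L' ** transpose L'"
  shows "L = L'"
proof -
  have "\<forall>i. L $ i $ j = L' $ i $ j" for j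
  \<comment> \<open>The number of predecessors serves as induction measure, the index type being an
    arbitrary finite linear order.\<close>
  proof (induction "card {..<j}" arbitrary: j rule: less_induct)
    case less
    have IH: "L $ i $ k = L' $ i $ k" if "k < j" for i k
    proof -
      have "card {..<k} < card {..<j}"
        using that by (intro psubset_card_mono) auto
      then show ?thesis using less by blast
    qed
    have expand: "(M ** transpose M) $ i $ j = (\<Sum>k<j. M $ i $ k * M $ j $ k) + M $ i $ j * M $ j $ j"
      if "lower_triangular M" for M :: "'n rmat" and i
    proof -
      have "(M ** transpose M) $ i $ j = (\<Sum>k\<in>UNIV. M $ i $ k * M $ j $ k)"
        by (simp add: matrix_matrix_mult_def transpose_def)
      also have "\<dots> = (\<Sum>k\<in>{..j}. M $ i $ k * M $ j $ k)"
        using that by (intro sum.mono_neutral_right) (auto simp: lower_triangular_def not_le)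
      also have "{..j} = insert j {..<j}" by auto
      finally show ?thesis by simp
    qed
    have cancel: "L $ i $ j * L $ j $ j = L' $ i $ j * L' $ j $ j" for i
      using expand[OF L(1), of i] expand[OF L'(1), of i] eq IH by simp
    have "(L $ j $ j)\<^sup>2 = (L' $ j $ j)\<^sup>2"
      using cancel[of j] by (simp add: power2_eq_square)
    then have "L $ j $ j = L' $ j $ j"
      using L(2)[of j] L'(2)[of j] by (simp add: power2_eq_iff_nonneg)
    then show ?case using cancel L(2)[of j] by (metis less_irrefl mult_right_cancel)
  qed
  then show ?thesis by (simp add: vec_eq_iff)
qed

lemma chol_mult_transpose:
  fixes Q :: "('n::{finite,linorder}) rmat"
  assumes "pos_def Q"
  shows "chol Q ** transpose (chol Q) = Q"
proof -
  have "\<exists>!L. lower_triangular L \<and> (\<forall>i. L $ i $ i > 0) \<and> Q = L ** transpose L"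
    using cholesky_exists[OF assms] cholesky_unique by (intro ex_ex1I) auto
  from theI'[OF this] show ?thesis unfolding chol_def by simp
qed

section \<open>Powers of a stable matrix\<close>

text \<open>Summing the recurrence bounds a partial sum by \<open>r\<close> times itself plus a
  constant, and \<open>r < 1\<close> allows solving for it.\<close>

lemma summable_of_contractive_recurrence:
  fixes x :: "nat \<Rightarrow> 'a::real_normed_vector"
  assumes rec: "\<And>k. norm (x (Suc k)) \<le> r * norm (x k) + b k"
    and r: "r < 1" and b: "summable b" "\<And>k. 0 \<le> b k"
  shows "summable (\<lambda>k. norm (x k))"
proof (rule summableI_nonneg_bounded)
  fix n
  have "(\<Sum>k<n. norm (x k)) \<le> (\<Sum>k<Suc n. norm (x k))" by simp
  also have "\<dots> = norm (x 0) + (\<Sum>k<n. norm (x (Suc k)))" by (rule sum.lessThan_Suc_shift)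
  also have "\<dots> \<le> norm (x 0) + (\<Sum>k<n. r * norm (x k) + b k)"
    by (intro add_left_mono sum_mono rec)
  also have "\<dots> = norm (x 0) + r * (\<Sum>k<n. norm (x k)) + (\<Sum>k<n. b k)"
    by (simp add: sum.distrib sum_distrib_left)
  also have "(\<Sum>k<n. b k) \<le> suminf b" using b by (intro sum_le_suminf) auto
  finally have "(1 - r) * (\<Sum>k<n. norm (x k)) \<le> norm (x 0) + suminf b"
    by (simp add: algebra_simps)
  then show "(\<Sum>k<n. norm (x k)) \<le> (norm (x 0) + suminf b) / (1 - r)"
    using r by (simp add: field_simps)
qed simp

text \<open>Linear dependence of an indexed family: a repeated vector gives a relation at once, and
  otherwise the family is a set too large to be independent.\<close>

lemma nontrivial_real_relation:
  fixes w :: "nat \<Rightarrow> 'a::euclidean_space"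
  obtains c k where "k \<le> DIM('a)" "c k \<noteq> (0::real)" "(\<Sum>i\<le>DIM('a). c i *\<^sub>R w i) = 0"
proof (cases "inj_on w {..DIM('a)}")
  case True
  then have "card (w ` {..DIM('a)}) = Suc (DIM('a))" by (simp add: card_image)
  then have "dependent (w ` {..DIM('a)})"
    by (intro dependent_biggerset) auto
  then obtain u v where u: "v \<in> w ` {..DIM('a)}" "u v \<noteq> 0" "(\<Sum>v\<in>w ` {..DIM('a)}. u v *\<^sub>R v) = 0"
    using dependent_finite[of "w ` {..DIM('a)}"] by auto
  moreover have "(\<Sum>i\<le>DIM('a). u (w i) *\<^sub>R w i) = 0"
    using u(3) by (simp add: sum.reindex[OF True])
  ultimately show thesis using that[of _ "u \<circ> w"] by auto
next
  case False
  then obtain i j where ij: "i \<le> DIM('a)" "j \<le> DIM('a)" "i \<noteq> j" "w i = w j"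
    by (auto simp: inj_on_def)
  define c where "c k = (if k = i then 1 else 0) - (if k = j then 1 else (0::real))" for k
  have "c k *\<^sub>R w k = (if k = i then w k else 0) - (if k = j then w k else 0)" for k
    by (simp add: c_def)
  then have "(\<Sum>k\<le>DIM('a). c k *\<^sub>R w k) = w i - w j"
    using ij by (simp add: sum_subtractf)
  then show thesis using that[of i c] ij by (auto simp: c_def)
qed

section \<open>Polynomials in a complex matrix acting on a vector\<close>

context
  fixes M :: "complex^'n^'n"
begin

text \<open>This is p(M) v, with iterates of the vector in place of matrix powers.\<close>

definition poly_act :: "complex poly \<Rightarrow> complex^'n \<Rightarrow> complex^'n" where
  "poly_act p v = (\<Sum>k\<le>degree p. coeff p k *s (((*v) M) ^^ k) v)"

lemma poly_act_0 [simp]: "poly_act 0 v = 0"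
  by (simp add: poly_act_def)

lemma poly_act_pCons: "poly_act (pCons a p) v = a *s v + poly_act p (M *v v)"
proof (cases "p = 0")
  case False
  then show ?thesis
    unfolding poly_act_def degree_pCons_eq[OF False] sum.atMost_Suc_shift
    by (simp add: funpow_swap1)
qed (simp add: poly_act_def)

lemma poly_act_add: "poly_act (p + q) v = poly_act p v + poly_act q v"
  by (induction p q arbitrary: v rule: poly_induct2)
     (simp_all add: poly_act_pCons vector_sadd_rdistrib algebra_simps)

lemma poly_act_smult: "poly_act (smult c p) v = c *s poly_act p v"
  by (induction p arbitrary: v) (simp_all add: poly_act_pCons vector_smult_assoc vector_add_ldistrib)

lemma poly_act_vec_add: "poly_act p (v + w) = poly_act p v + poly_act p w"
  by (induction p arbitrary: v w)
     (simp_all add: poly_act_pCons vector_add_ldistrib matrix_vector_right_distrib algebra_simps)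

lemma poly_act_vec_smult: "poly_act p (c *s v) = c *s poly_act p v"
  by (induction p arbitrary: v)
     (simp_all add: poly_act_pCons vector_add_ldistrib vector_smult_assoc vector_scalar_commute mult.commute)

lemma poly_act_vec_mult: "poly_act p (M *v v) = M *v poly_act p v"
  by (induction p arbitrary: v)
     (simp_all add: poly_act_pCons matrix_vector_right_distrib vector_scalar_commute)

lemma poly_act_monom: "poly_act (monom a k) v = a *s (((*v) M) ^^ k) v"
  by (induction k arbitrary: v) (simp_all add: monom_0 monom_Suc poly_act_pCons funpow_swap1)

lemma poly_act_sum: "poly_act (sum p S) v = (\<Sum>i\<in>S. poly_act (p i) v)"
  by (induction S rule: infinite_finite_induct) (simp_all add: poly_act_add)

text \<open>With the factor outside, a root exposes \<open>poly_act q v\<close> as a candidate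
  eigenvector; with the factor inside, \<open>q\<close> annihilates a new vector.\<close>

lemma poly_act_linear_factor:
  "poly_act ([:- c, 1:] * q) v = M *v poly_act q v - c *s poly_act q v"
  "poly_act ([:- c, 1:] * q) v = poly_act q (M *v v - c *s v)"
proof -
  have "poly_act ([:- c, 1:] * q) v = poly_act q (M *v v) + (- c) *s poly_act q v"
  proof -
    have "[:- c, 1:] * q = smult (- c) q + pCons 0 q" by simp
    then show ?thesis by (simp only: poly_act_add poly_act_smult poly_act_pCons) simp
  qed
  then show "poly_act ([:- c, 1:] * q) v = M *v poly_act q v - c *s poly_act q v"
    "poly_act ([:- c, 1:] * q) v = poly_act q (M *v v - c *s v)"
    using poly_act_vec_add[of q "M *v v" "(- c) *s v"] poly_act_vec_smult[of q "- c" v]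
    by (simp_all add: poly_act_vec_mult)
qed

text \<open>Counting dimension over the reals, the iterates of \<open>v\<close> up to the dimension
  of the space are dependent, and the relation supplies the coefficients.\<close>

lemma annihilating_poly_exists: "\<exists>p. p \<noteq> 0 \<and> poly_act p v = 0"
proof -
  let ?N = "DIM(complex^'n)"
  obtain c k where c: "k \<le> ?N" "c k \<noteq> (0::real)" "(\<Sum>i\<le>?N. c i *\<^sub>R (((*v) M) ^^ i) v) = 0"
    using nontrivial_real_relation[of "\<lambda>i. (((*v) M) ^^ i) v"] by blast
  define p where "p = (\<Sum>i\<le>?N. monom (complex_of_real (c i)) i)"
  have "coeff p k = complex_of_real (c k)"
    using c(1) by (simp add: p_def coeff_sum)
  then have "p \<noteq> 0" using c(2) by auto
  moreover have "complex_of_real r *s x = r *\<^sub>R x" for r :: real and x :: "complex^'n"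
    unfolding vec_eq_iff vector_scaleR_component vector_smult_component
    by (simp add: scaleR_conv_of_real)
  then have "poly_act p v = 0"
    using c(3) by (simp add: p_def poly_act_sum poly_act_monom)
  ultimately show ?thesis by blast
qed

text \<open>A root of the annihilating polynomial either is an eigenvalue, so that splitting off its
  factor costs a contractive recurrence, or its factor is injective and can be dropped.\<close>

lemma summable_powers_of_annihilating_poly:
  assumes stable: "\<And>c v. v \<noteq> 0 \<Longrightarrow> M *v v = c *s v \<Longrightarrow> cmod c < 1"
    and "p \<noteq> 0" "poly_act p v = 0"
  shows "summable (\<lambda>k. norm ((((*v) M) ^^ k) v))"
  using assms(2,3)
proof (induction "degree p" arbitrary: p v rule: less_induct)
  case less
  show ?case
  proof (cases "degree p = 0")
    case True
    then obtain a where "p = [:a:]" by (rule degree_eq_zeroE)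
    then have "v = 0" using less.prems by (simp add: poly_act_pCons)
    moreover have "(((*v) M) ^^ k) 0 = 0" for k by (induction k) auto
    ultimately show ?thesis by simp
  next
    case False
    then have "\<not> constant (poly p)" by (simp add: constant_degree)
    then obtain z where "poly p z = 0" using fundamental_theorem_of_algebra by blast
    then obtain q where q: "p = [:- z, 1:] * q" by (auto simp: poly_eq_0_iff_dvd dvd_def)
    then have "q \<noteq> 0" using less.prems by auto
    then have deg: "degree q < degree p"
      unfolding q by (subst degree_mult_eq) auto
    show ?thesis
    proof (cases "cmod z < 1")
      case True
      \<comment> \<open>\<open>q\<close> annihilates \<open>w\<close>, so its iterates are summable
        by induction, and they are the inhomogeneity in the recurrence with factor \<open>z\<close>
        for the iterates of \<open>v\<close>.\<close>
      define w where "w = M *v v - z *s v"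
      have "poly_act q w = 0" using less.prems(2) by (simp only: q poly_act_linear_factor(2) w_def)
      then have sw: "summable (\<lambda>k. norm ((((*v) M) ^^ k) w))"
        using less.hyps[OF deg \<open>q \<noteq> 0\<close>] by blast
      have pw: "(((*v) M) ^^ k) w = (((*v) M) ^^ Suc k) v - z *s (((*v) M) ^^ k) v" for k
        by (induction k) (simp_all add: w_def matrix_vector_mult_diff_distrib vector_scalar_commute)
      have norm_smult: "norm (z *s x) = cmod z * norm x" for x :: "complex^'n"
        by (simp add: norm_vec_def norm_mult L2_set_right_distrib)
      show ?thesis
      proof (rule summable_of_contractive_recurrence[OF _ True sw])
        fix k
        have "(((*v) M) ^^ Suc k) v = z *s (((*v) M) ^^ k) v + (((*v) M) ^^ k) w"
          unfolding pw by simp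
        then show "norm ((((*v) M) ^^ Suc k) v) \<le> cmod z * norm ((((*v) M) ^^ k) v) + norm ((((*v) M) ^^ k) w)"
          using norm_triangle_ineq norm_smult by metis
      qed simp
    next
      case False
      \<comment> \<open>If nonzero, this vector would be an eigenvector for an eigenvalue of modulus
        at least 1. So \<open>q\<close>, of smaller degree, already annihilates
        \<open>v\<close>.\<close>
      have "M *v poly_act q v = z *s poly_act q v"
        using less.prems(2) unfolding q poly_act_linear_factor(1) by simp
      then have "poly_act q v = 0" using stable False by blast
      then show ?thesis using less.hyps[OF deg \<open>q \<noteq> 0\<close>] by blast
    qed
  qed
qed

end

text \<open>Pass to complex vectors: the embedding \<open>cx\<close> is isometric and intertwines
  \<open>A\<close> with its complexification.\<close>

lemma schur_stable_summable_powers: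
  fixes A :: "real^'n^'n"
  assumes "schur_stable A"
  shows "summable (\<lambda>k. norm ((((*v) A) ^^ k) x))"
proof -
  define M where "M = (\<chi> i j. complex_of_real (A $ i $ j))"
  define cx :: "real^'n \<Rightarrow> complex^'n" where "cx x = (\<chi> i. complex_of_real (x $ i))" for x
  have "cmod c < 1" if "v \<noteq> 0" "M *v v = c *s v" for c v
    using assms that unfolding schur_stable_def matrix_vector_mult_def M_def by simp blast
  then have "summable (\<lambda>k. norm ((((*v) M) ^^ k) (cx x)))"
    using annihilating_poly_exists[of M "cx x"] summable_powers_of_annihilating_poly[of M] by metis
  moreover have "(((*v) M) ^^ k) (cx x) = cx ((((*v) A) ^^ k) x)" for k
    by (induction k) (simp_all add: M_def cx_def matrix_vector_mult_def vec_eq_iff)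
  moreover have "norm (cx y) = norm y" for y
    by (simp add: cx_def norm_vec_def)
  ultimately show ?thesis by simp
qed

section \<open>The reachability Gramian\<close>

lemma norm_gram_le:
  fixes W :: "real^'m^'n"
  shows "norm (W ** transpose W) \<le> (real CARD('n))\<^sup>2 * (\<Sum>l\<in>UNIV. (norm (column l W))\<^sup>2)"
proof -
  have entry: "\<bar>(W ** transpose W) $ i $ j\<bar> \<le> (\<Sum>l\<in>UNIV. (norm (column l W))\<^sup>2)" for i j
  proof -
    have "\<bar>(W ** transpose W) $ i $ j\<bar> \<le> (\<Sum>l\<in>UNIV. \<bar>W $ i $ l * W $ j $ l\<bar>)"
      by (simp add: matrix_matrix_mult_def transpose_def sum_abs)
    also have "\<dots> \<le> (\<Sum>l\<in>UNIV. (norm (column l W))\<^sup>2)"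
    proof (rule sum_mono)
      fix l
      have "\<bar>W $ i $ l\<bar> \<le> norm (column l W)" for i
        using component_le_norm_cart[of "column l W" i] by (simp add: column_def)
      then show "\<bar>W $ i $ l * W $ j $ l\<bar> \<le> (norm (column l W))\<^sup>2"
        unfolding abs_mult power2_eq_square by (intro mult_mono) auto
    qed
    finally show ?thesis .
  qed
  have "norm (W ** transpose W) \<le> (\<Sum>i\<in>UNIV. norm ((W ** transpose W) $ i))"
    by (simp add: norm_vec_def L2_set_le_sum)
  also have "\<dots> \<le> (\<Sum>i\<in>UNIV. \<Sum>j\<in>UNIV. \<bar>(W ** transpose W) $ i $ j\<bar>)"
    by (intro sum_mono norm_le_l1_cart)
  also have "\<dots> \<le> (\<Sum>i\<in>(UNIV::'n set). \<Sum>j\<in>(UNIV::'n set). \<Sum>l\<in>UNIV. (norm (column l W))\<^sup>2)"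
    by (intro sum_mono entry)
  finally show ?thesis by (simp add: power2_eq_square)
qed

lemma summable_power2:
  fixes a :: "nat \<Rightarrow> real"
  assumes "summable a" "\<And>k. 0 \<le> a k"
  shows "summable (\<lambda>k. (a k)\<^sup>2)"
proof (rule summable_comparison_test_ev[OF _ assms(1)])
  have "eventually (\<lambda>k. a k < 1) sequentially"
    using summable_LIMSEQ_zero[OF assms(1)] by (rule order_tendstoD) simp
  then show "eventually (\<lambda>k. norm ((a k)\<^sup>2) \<le> a k) sequentially"
  proof eventually_elim
    case (elim k)
    then show ?case using mult_right_mono[of "a k" 1 "a k"] assms(2)[of k] by (simp add: power2_eq_square)
  qed
qed

lemma inner_gram:
  fixes W :: "real^'m^'n"
  shows "x \<bullet> ((W ** transpose W) *v x) = (transpose W *v x) \<bullet> (transpose W *v x)"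
  using inner_congruence[of x W "mat 1"] by simp

text \<open>\<open>S\<close> is the Gramian series, whose terms are bounded by squared norms of
  stable iterates of the columns of \<open>B\<close>. Conjugation by \<open>A\<close> shifts the
  series by one term, leaving \<open>B ** transpose B\<close> as the difference.\<close>

lemma reachable_lyapunov_solution:
  fixes A :: "real^'n^'n" and B :: "real^'m^'n"
  assumes stable: "schur_stable A" and reach: "reachable A B"
  obtains S where "pos_def S" "S - A ** S ** transpose A = B ** transpose B"
proof -
  define W where "W k = ((\<lambda>X. A ** X) ^^ k) B" for k
  have col: "column l (W k) = (((*v) A) ^^ k) (column l B)" for k l
  proof (induction k)
    case (Suc k)
    have "column l (W (Suc k)) = A *v column l (W k)"
      by (simp add: W_def column_def matrix_matrix_mult_def matrix_vector_mult_def vec_eq_iff)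
    then show ?case by (simp add: Suc)
  qed (simp add: W_def)
  define X where "X k = W k ** transpose (W k)" for k
  have summable_X: "summable X"
  proof (rule summable_comparison_test')
    show "summable (\<lambda>k. (real CARD('n))\<^sup>2 * (\<Sum>l\<in>UNIV. (norm (column l (W k)))\<^sup>2))"
      unfolding col
      by (intro summable_mult summable_sum summable_power2 schur_stable_summable_powers[OF stable]) simp
    show "norm (X k) \<le> (real CARD('n))\<^sup>2 * (\<Sum>l\<in>UNIV. (norm (column l (W k)))\<^sup>2)" if "0 \<le> k" for k
      unfolding X_def by (rule norm_gram_le)
  qed
  define S where "S = suminf X"
  have X_Suc: "X (Suc k) = A ** X k ** transpose A" for k
    by (simp add: X_def W_def matrix_transpose_mul matrix_mul_assoc)
  have "A ** S ** transpose A = (\<Sum>k. X (Suc k))"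
    unfolding S_def X_Suc
    by (intro bounded_linear.suminf[where f = "\<lambda>Z. A ** Z ** transpose A"] summable_X)
       (simp add: linear_matrix_mult_both flip: linear_conv_bounded_linear)
  also have "\<dots> = S - X 0"
    unfolding S_def by (rule suminf_split_head[OF summable_X])
  finally have "S - A ** S ** transpose A = B ** transpose B"
    by (simp add: X_def W_def)
  moreover have "pos_def S"
  proof -
    have "linear (transpose :: real^'n^'n \<Rightarrow> real^'n^'n)"
      by (rule linearI) (simp_all add: transpose_def vec_eq_iff)
    then have "transpose S = (\<Sum>k. transpose (X k))"
      unfolding S_def by (intro bounded_linear.suminf summable_X) (simp add: linear_conv_bounded_linear)
    moreover have "transpose (X k) = X k" for k
      by (simp add: X_def matrix_transpose_mul)
    ultimately have "sym_mat S" by (simp add: sym_mat_def S_def)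
    moreover have "0 < x \<bullet> (S *v x)" if "x \<noteq> 0" for x
    proof -
      have "linear (\<lambda>Z::real^'n^'n. x \<bullet> (Z *v x))"
        by (rule linearI) (simp_all add: matrix_vector_mult_add_rdistrib inner_add_right
            scaleR_matrix_vector_assoc[symmetric])
      then have bl: "bounded_linear (\<lambda>Z::real^'n^'n. x \<bullet> (Z *v x))" by (simp add: linear_conv_bounded_linear)
      have "x \<bullet> (S *v x) = (\<Sum>k. x \<bullet> (X k *v x))"
        unfolding S_def by (rule bounded_linear.suminf[OF bl summable_X])
      moreover have "\<exists>k. 0 < x \<bullet> (X k *v x)"
      proof (rule ccontr)
        assume "\<not> (\<exists>k. 0 < x \<bullet> (X k *v x))"
        then have "transpose (W k) *v x = 0" for k
          unfolding X_def inner_gram inner_gt_zero_iff by blast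
        then have zero: "column l (W k) \<bullet> x = 0" for k l
          unfolding vec_eq_iff
          by (simp add: matrix_vector_mult_def transpose_def column_def inner_vec_def
              del: transpose_matrix_vector)
        \<comment> \<open>If the form vanished at \<open>x\<close>, then \<open>x\<close> would be
          orthogonal to all columns of the iterates of \<open>B\<close>, which span the space by
          reachability.\<close>
        have "span (\<Union>k\<in>{..<CARD('n)}. columns (W k)) \<subseteq> {y. y \<bullet> x = 0}"
          using zero by (intro span_minimal) (auto simp: columns_def subspace_def inner_add_left)
        then have "x \<in> {y. y \<bullet> x = 0}"
          using reach unfolding reachable_def W_def by blast
        then show False using that by simp
      qed
      moreover have "summable (\<lambda>k. x \<bullet> (X k *v x))"
        by (rule bounded_linear.summable[OF bl summable_X])
      moreover have "0 \<le> x \<bullet> (X k *v x)" for k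
        by (simp add: X_def inner_gram del: transpose_matrix_vector)
      ultimately show ?thesis
        using suminf_pos_iff[of "\<lambda>k. x \<bullet> (X k *v x)"] by simp
    qed
    ultimately show ?thesis by (simp add: pos_def_def)
  qed
  ultimately show thesis using that by blast
qed

section \<open>The divergence as a trace function\<close>

lemma matrix_inv_cancel:
  assumes "invertible M"
  shows "M ** matrix_inv M = mat 1" "matrix_inv M ** M = mat 1"
  using assms someI_ex[of "\<lambda>M'. M ** M' = mat 1 \<and> M' ** M = mat 1"]
  by (simp_all add: invertible_def matrix_inv_def)

lemma matrix_inv_eqI:
  fixes M :: "real^'n^'n"
  assumes "M ** N = mat 1"
  shows "matrix_inv M = N"
proof -
  have "invertible M" using assms by (auto simp: invertible_right_inverse)
  then show ?thesis using assms matrix_inv_cancel(2)[of M] by (metis matrix_mul_assoc matrix_mul_lid matrix_mul_rid)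
qed

text \<open>Additive constants are dropped: the general branch plus \<open>1 / tau\<close> tends to
  \<open>x - ln x - 1\<close> as \<open>tau\<close> tends to 0.\<close>

definition div_fun :: "real \<Rightarrow> real \<Rightarrow> real" where
  "div_fun tau x = (if tau = 0 then x - ln x else 1 / (tau * (tau - 1)) * x powr tau - 1 / (tau - 1) * x)"

text \<open>One derivative formula covers both branches. For \<open>tau < 1\<close> the power
  \<open>x powr (tau - 1)\<close> decreases from infinity, and dividing by the negative
  \<open>tau - 1\<close> reverses this.\<close>

lemma convex_barrier_div_fun:
  assumes tau: "tau < 1"
  shows "convex_barrier (div_fun tau) (\<lambda>x. (x powr (tau - 1) - 1) / (tau - 1))"
proof
  fix x :: real assume x: "x > 0"
  show "(div_fun tau has_real_derivative (x powr (tau - 1) - 1) / (tau - 1)) (at x)"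
  proof (cases "tau = 0")
    case True
    have "((\<lambda>x. x - ln x) has_real_derivative 1 - 1 / x) (at x)"
      using x by (auto intro!: derivative_eq_intros)
    then show ?thesis
      using True x by (simp add: div_fun_def[abs_def] powr_minus divide_inverse)
  next
    case False
    have "((\<lambda>x. 1 / (tau * (tau - 1)) * x powr tau - 1 / (tau - 1) * x) has_real_derivative
        1 / (tau * (tau - 1)) * (tau * x powr (tau - 1)) - 1 / (tau - 1) * 1) (at x)"
      using x by (intro DERIV_diff DERIV_cmult has_real_derivative_powr DERIV_ident)
    then show ?thesis
      using False tau by (simp add: div_fun_def[abs_def] diff_divide_distrib)
  qed
next
  fix x y :: real assume xy: "0 < x" "x < y"
  have "y powr (tau - 1) < x powr (tau - 1)"
    using xy tau by (intro powr_less_mono2_neg) auto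
  then show "(x powr (tau - 1) - 1) / (tau - 1) < (y powr (tau - 1) - 1) / (tau - 1)"
    using tau by (simp add: divide_strict_right_mono_neg)
next
  have "2 powr (tau - 1) < 2 powr (0::real)"
    using tau by (intro powr_less_mono) auto
  then show "\<exists>x>0. 0 < (x powr (tau - 1) - 1) / (tau - 1)"
    using tau by (intro exI[of _ 2]) (auto simp: divide_neg_neg)
next
  show "filterlim (\<lambda>x. (x powr (tau - 1) - 1) / (tau - 1)) at_bot (at_right 0)"
    using tau by real_asymp
qed

text \<open>The linear term becomes the trace of the congruent matrix by cyclicity. For
  \<open>tau = 0\<close> the logarithms turn into log determinants, which the congruence changes by
  a constant independent of \<open>S\<close>.\<close>

lemma D_T_eq_trace_div_fun:
  fixes Q :: "('n::{finite,linorder}) rmat"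
  assumes Q: "pos_def Q"
  obtains c where "\<And>S. pos_def S \<Longrightarrow> D_T tau S Q =
    trace (mat_fun (div_fun tau) (matrix_inv (chol Q) ** S ** transpose (matrix_inv (chol Q)))) + c"
proof -
  define L where "L = chol Q"
  define T where "T = matrix_inv L"
  have LL: "L ** transpose L = Q" unfolding L_def by (rule chol_mult_transpose[OF Q])
  have "invertible L"
    using LL pos_def_imp_invertible[OF Q] by (metis invertible_right_inverse matrix_mul_assoc)
  then have LT: "L ** T = mat 1" "T ** L = mat 1" by (simp_all add: T_def matrix_inv_cancel)
  have "invertible T" using LT by (auto simp: invertible_def)
  have "Q ** (transpose T ** T) = mat 1"
  proof -
    have "transpose L ** transpose T = mat 1"
      using LT(2) by (metis matrix_transpose_mul transpose_mat)
    then have "L ** (transpose L ** transpose T) ** T = mat 1" using LT by simp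
    then show ?thesis by (simp add: LL[symmetric] matrix_mul_assoc)
  qed
  then have Qinv: "matrix_inv Q = transpose T ** T" by (rule matrix_inv_eqI)
  have tr: "trace (S ** matrix_inv Q) = trace (T ** S ** transpose T)" for S
    unfolding Qinv matrix_mul_assoc by (subst trace_mul_sym) (simp add: matrix_mul_assoc)
  show thesis
  proof (rule that)
    fix S :: "'n rmat" assume S: "pos_def S"
    define P where "P = T ** S ** transpose T"
    have P: "pos_def P" unfolding P_def by (rule pos_def_congruence[OF S \<open>invertible T\<close>])
    obtain U d where U: "orthogonal_matrix U" "P = U ** diag_mat d ** transpose U" "\<And>i. d i > 0"
      using pos_def_diagonalization[OF P] by blast
    show "D_T tau S Q = trace (mat_fun (div_fun tau) (matrix_inv (chol Q) ** S ** transpose (matrix_inv (chol Q)))) +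
      (if tau = 0 then trace (mat_log Q) + ln ((det T)\<^sup>2) - real CARD('n) else real CARD('n) / tau)"
    proof (cases "tau = 0")
      case True
      have det: "det P = (det T)\<^sup>2 * det S" by (simp add: P_def det_mul power2_eq_square)
      have "det T \<noteq> 0" using \<open>invertible T\<close> by (simp add: invertible_det_nz)
      then have "ln (det P) = ln ((det T)\<^sup>2) + ln (det S)"
        unfolding det using trace_mat_log(2)[OF S] by (intro ln_mult_pos) auto
      moreover have "trace (mat_fun (div_fun tau) P) = trace P - trace (mat_log P)"
        using True U by (simp add: mat_log_def trace_mat_fun_diagonalization trace_diagonalization
            div_fun_def sum_subtractf)
      ultimately show ?thesis
        using True tr[of S] trace_mat_log(1)[OF S] trace_mat_log(1)[OF P]
        by (simp add: D_T_def trace_add trace_sub P_def T_def L_def)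
    next
      case False
      then have "trace (mat_fun (div_fun tau) P) =
          1 / (tau * (tau - 1)) * trace (mat_powr P tau) - 1 / (tau - 1) * trace P"
        using U by (simp add: mat_powr_def trace_mat_fun_diagonalization trace_diagonalization
            div_fun_def sum_subtractf sum_distrib_left sum_divide_distrib)
      then show ?thesis
        using False tr[of S] unfolding D_T_def trace_sub trace_scaleR
        by (simp add: P_def T_def L_def)
    qed
  qed
qed

section \<open>The feasible set\<close>

lemma linear_V_op: "linear (V_op A B)"
proof -
  have "linear (\<lambda>Q. Q - A ** Q ** transpose A)"
    by (intro linear_compose_sub linear_ident linear_matrix_mult_both)
  from linear_compose[OF this linear_matrix_mult_both[of "proj_perp B" "proj_perp B"]] show ?thesis
    by (simp add: o_def V_op_def[abs_def])
qed

text \<open>Full column rank makes the Gram matrix of \<open>B\<close> invertible, since its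
  quadratic form is the squared norm of \<open>B *v x\<close>.\<close>

lemma proj_perp_annihilates:
  fixes B :: "real^'m^'n"
  assumes "rank B = CARD('m)"
  shows "proj_perp B ** B = 0"
proof -
  have inj: "inj ((*v) B)" using assms by (simp add: full_rank_injective)
  have "x = 0" if "(transpose B ** B) *v x = 0" for x
  proof -
    have "(B *v x) \<bullet> (B *v x) = x \<bullet> ((transpose B ** B) *v x)"
      by (metis dot_lmul_matrix matrix_vector_mul_assoc transpose_matrix_vector transpose_transpose)
    then have "B *v x = B *v 0" using that by simp
    then show ?thesis using inj by (simp add: inj_def)
  qed
  then have "invertible (transpose B ** B)"
    unfolding invertible_left_inverse matrix_left_invertible_ker by blast
  then have "B ** (matrix_inv (transpose B ** B) ** (transpose B ** B)) = B"
    by (simp add: matrix_inv_cancel)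
  then show ?thesis
    unfolding proj_perp_def linear_diff[OF linear_matrix_mult_right] by (simp add: matrix_mul_assoc)
qed

lemma feasible_exists:
  fixes A :: "real^'n^'n" and B :: "real^'m^'n"
  assumes "schur_stable A" "reachable A B" "rank B = CARD('m)"
  obtains S where "pos_def S" "V_op A B S = 0"
proof -
  obtain S where S: "pos_def S" "S - A ** S ** transpose A = B ** transpose B"
    using reachable_lyapunov_solution[OF assms(1,2)] by blast
  have "V_op A B S = proj_perp B ** B ** (transpose B ** proj_perp B)"
    by (simp add: V_op_def S(2) matrix_mul_assoc)
  then have "V_op A B S = 0"
    by (simp add: proj_perp_annihilates[OF assms(3)] linear_0[OF linear_matrix_mult_right])
  then show thesis using that S(1) by blast
qed

text \<open>Congruence by \<open>T\<close>, with inverse congruence by \<open>L\<close>, maps the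
  feasible set onto the positive definite part of a linear subspace and turns the divergence into
  \<open>tr_fun\<close> plus a constant.\<close>

lemma D_T_unique_minimizer:
  fixes A :: "('n::{finite,linorder}) rmat"
    and B :: "((real, 'm::finite) vec, 'n) vec"
    and Q :: "'n rmat"
  assumes Q: "pos_def Q" and tau: "tau < 1"
    and feasible: "pos_def S0" "V_op A B S0 = 0"
  shows "\<exists>!S. pos_def S \<and> V_op A B S = 0 \<and>
    (\<forall>S'. pos_def S' \<and> V_op A B S' = 0 \<longrightarrow> D_T tau S Q \<le> D_T tau S' Q)"
proof -
  interpret convex_barrier "div_fun tau" "\<lambda>x. (x powr (tau - 1) - 1) / (tau - 1)"
    by (rule convex_barrier_div_fun[OF tau])
  define L where "L = chol Q"
  define T where "T = matrix_inv L"
  obtain c where D_T: "\<And>S. pos_def S \<Longrightarrow> D_T tau S Q = tr_fun (T ** S ** transpose T) + c"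
    unfolding tr_fun_def T_def L_def using D_T_eq_trace_div_fun[OF Q, of tau] by blast
  have "invertible L"
    using chol_mult_transpose[OF Q] pos_def_imp_invertible[OF Q]
    by (metis L_def invertible_right_inverse matrix_mul_assoc)
  then have LT: "L ** T = mat 1" "T ** L = mat 1" by (simp_all add: T_def matrix_inv_cancel)
  then have "invertible T" by (auto simp: invertible_def)
  have LT': "transpose T ** transpose L = mat 1" "transpose L ** transpose T = mat 1"
    using LT by (metis matrix_transpose_mul transpose_mat)+
  have TL: "T ** (L ** X ** transpose L) ** transpose T = X" for X
    using LT LT' by (metis (no_types, lifting) matrix_mul_assoc matrix_mul_lid matrix_mul_rid)
  have LTX: "L ** (T ** X ** transpose T) ** transpose L = X" for X
    using LT LT' by (metis (no_types, lifting) matrix_mul_assoc matrix_mul_lid matrix_mul_rid)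
  \<comment> \<open>Leaving positive definiteness out of \<open>K\<close> makes it the kernel of a
    linear map, hence both convex and closed.\<close>
  define K where "K = {P. V_op A B (L ** P ** transpose L) = 0}"
  from linear_compose[OF linear_matrix_mult_both[of L "transpose L"] linear_V_op[of A B]]
  have "linear (\<lambda>P. V_op A B (L ** P ** transpose L))"
    by (simp add: o_def)
  then have "subspace K" unfolding K_def by (rule linear_subspace_kernel)
  then have K: "convex K" "closed K" by (simp_all add: subspace_imp_convex closed_subspace)
  have to_K: "pos_def (T ** S ** transpose T) \<and> T ** S ** transpose T \<in> K"
    if "pos_def S" "V_op A B S = 0" for S
    using that LTX pos_def_congruence[OF _ \<open>invertible T\<close>] by (simp add: K_def)
  have from_K: "pos_def (L ** P ** transpose L) \<and> V_op A B (L ** P ** transpose L) = 0"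
    if "pos_def P" "P \<in> K" for P
    using that pos_def_congruence[OF _ \<open>invertible L\<close>] by (simp add: K_def)
  obtain P where P: "pos_def P" "P \<in> K" "\<And>X. pos_def X \<Longrightarrow> X \<in> K \<Longrightarrow> tr_fun P \<le> tr_fun X"
    using tr_fun_minimizer_exists[OF K] to_K[OF feasible] by blast
  show ?thesis
  proof (rule ex1I[of _ "L ** P ** transpose L"])
    show "pos_def (L ** P ** transpose L) \<and> V_op A B (L ** P ** transpose L) = 0 \<and>
        (\<forall>S'. pos_def S' \<and> V_op A B S' = 0 \<longrightarrow> D_T tau (L ** P ** transpose L) Q \<le> D_T tau S' Q)"
      using from_K[OF P(1,2)] to_K P(3) D_T TL by simp
  next
    fix S
    assume S: "pos_def S \<and> V_op A B S = 0 \<and>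
        (\<forall>S'. pos_def S' \<and> V_op A B S' = 0 \<longrightarrow> D_T tau S Q \<le> D_T tau S' Q)"
    have "tr_fun (T ** S ** transpose T) \<le> tr_fun X" if "pos_def X" "X \<in> K" for X
    proof -
      have "D_T tau S Q \<le> D_T tau (L ** X ** transpose L) Q" using S from_K[OF that] by blast
      then show ?thesis using S from_K[OF that] by (simp add: D_T TL)
    qed
    then have "T ** S ** transpose T = P"
      using to_K S P by (intro tr_fun_minimizer_unique[OF K(1)]) auto
    then show "S = L ** P ** transpose L" using LTX by metis
  qed
qed

theorem theorem2:
  fixes A :: "('n::{finite,linorder}) rmat"
    and B :: "((real, 'm::finite) vec, 'n) vec"
    and SigmaC :: "'n rmat"
    and nu :: nat
  assumes "CARD('n) > CARD('m)"
    and "schur_stable A"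
    and "rank B = CARD('m)"
    and "reachable A B"
    and "pos_def SigmaC"
    and "nu \<ge> 1"
  shows "\<exists>!S. pos_def S \<and> V_op A B S = 0 \<and>
           (\<forall>S'. pos_def S' \<and> V_op A B S' = 0 \<longrightarrow>
                 D_T (1 - 1 / real nu) S SigmaC \<le> D_T (1 - 1 / real nu) S' SigmaC)"
proof -
  obtain S0 where "pos_def S0" "V_op A B S0 = 0"
    using feasible_exists assms by blast
  \<comment> \<open>The exponents are 0, 1/2, 2/3 and so on; \<open>nu = 1\<close> is the Burg case
    \<open>tau = 0\<close>.\<close>
  moreover have "1 - 1 / real nu < 1" using assms(6) by simp
  ultimately show ?thesis using assms(5) by (intro D_T_unique_minimizer)
qed

end
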